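(* Let $g\in L^\infty(\mathbb T)$ admit a factorization $g=g_-\,\theta^{-N}g_+^{-1}$, where: - $\overline{g_-}$ and $g_+$ are outer functions in $H^2$; - $g_+^2$ is rigid in $H^1$; - $\theta$ is a non-constant inner function; - $N\in\mathbb Z$. Then $\ker T_g\neq\{0\}$ if and only if $N>0$. Moreover, if $N>0$ and $\theta$ is a finite Blaschke product of degree $n$, then $\dim\ker T_g=nN$; if $N>0$ and $\theta$ is not a finite Blaschke product, then $\dim\ker T_g=\infty$.
   Context: $H^p$ denotes the Hardy spaces of the unit disc, identified with boundary functions on $\mathbb T$. $T_g$ is the Toeplitz operator $f\mapsto P(gf)$ on $H^2$, where $P$ is the orthogonal projection of $L^2(\mathbb T)$ onto $H^2$. A function $f\in H^1\setminus\{0\}$ is rigid if, whenever $g\in H^1$ and $g/f>0$ a.e. on $\mathbb T$, one has $g=\lambda f$ for some $\lambda>0$. *)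

theory Defs
  imports "HOL-Analysis.Analysis"
begin

text \<open>Functions on the unit circle T are represented as maps complex \<Rightarrow> complex,
  of which only the values f (cis t), t in [0, 2 pi], matter; everything is
  understood modulo equality almost everywhere (normalized arc length).\<close>

definition ae_T :: "(complex \<Rightarrow> bool) \<Rightarrow> bool" where
  "ae_T P \<longleftrightarrow> (AE t in lborel. t \<in> {0..2*pi} \<longrightarrow> P (cis t))"

definition meas_T :: "(complex \<Rightarrow> complex) \<Rightarrow> bool" where
  "meas_T f \<longleftrightarrow> set_borel_measurable lborel {0..2*pi} (\<lambda>t. f (cis t))"

definition L1_T :: "(complex \<Rightarrow> complex) \<Rightarrow> bool" where
  "L1_T f \<longleftrightarrow> set_integrable lborel {0..2*pi} (\<lambda>t. f (cis t))"

definition L2_T :: "(complex \<Rightarrow> complex) \<Rightarrow> bool" where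
  "L2_T f \<longleftrightarrow> meas_T f \<and> set_integrable lborel {0..2*pi} (\<lambda>t. (norm (f (cis t)))\<^sup>2)"

definition Linf_T :: "(complex \<Rightarrow> complex) \<Rightarrow> bool" where
  "Linf_T f \<longleftrightarrow> meas_T f \<and> (\<exists>C. ae_T (\<lambda>z. norm (f z) \<le> C))"

definition fourier_coeff :: "(complex \<Rightarrow> complex) \<Rightarrow> int \<Rightarrow> complex" where
  "fourier_coeff f n =
     (LINT t:{0..2*pi}|lborel. f (cis t) * cis (- (of_int n * t))) / complex_of_real (2*pi)"

text \<open>Hardy spaces, identified with boundary functions.\<close>
definition H1 :: "(complex \<Rightarrow> complex) \<Rightarrow> bool" where
  "H1 f \<longleftrightarrow> L1_T f \<and> (\<forall>n<0. fourier_coeff f n = 0)"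

definition H2 :: "(complex \<Rightarrow> complex) \<Rightarrow> bool" where
  "H2 f \<longleftrightarrow> L2_T f \<and> (\<forall>n<0. fourier_coeff f n = 0)"

definition Hinf :: "(complex \<Rightarrow> complex) \<Rightarrow> bool" where
  "Hinf f \<longleftrightarrow> Linf_T f \<and> (\<forall>n<0. fourier_coeff f n = 0)"

definition hardy_ext :: "(complex \<Rightarrow> complex) \<Rightarrow> complex \<Rightarrow> complex" where
  "hardy_ext f z = (\<Sum>n. fourier_coeff f (int n) * z ^ n)"

definition inner_fn :: "(complex \<Rightarrow> complex) \<Rightarrow> bool" where
  "inner_fn \<theta> \<longleftrightarrow> Hinf \<theta> \<and> ae_T (\<lambda>z. norm (\<theta> z) = 1)"

definition outer_fn :: "(complex \<Rightarrow> complex) \<Rightarrow> bool" where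
  "outer_fn f \<longleftrightarrow> H1 f \<and>
     set_integrable lborel {0..2*pi} (\<lambda>t. ln (norm (f (cis t)))) \<and>
     (\<exists>c. norm c = 1 \<and> (\<forall>z. norm z < 1 \<longrightarrow>
        hardy_ext f z = c * exp ((LINT t:{0..2*pi}|lborel.
            (cis t + z) / (cis t - z) * complex_of_real (ln (norm (f (cis t)))))
            / complex_of_real (2*pi))))"

definition rigid :: "(complex \<Rightarrow> complex) \<Rightarrow> bool" where
  "rigid f \<longleftrightarrow> H1 f \<and> \<not> ae_T (\<lambda>z. f z = 0) \<and>
     (\<forall>h. H1 h \<and> ae_T (\<lambda>z. Im (h z / f z) = 0 \<and> Re (h z / f z) > 0) \<longrightarrow>
        (\<exists>l::real. l > 0 \<and> ae_T (\<lambda>z. h z = complex_of_real l * f z)))"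

definition finite_blaschke :: "nat \<Rightarrow> (complex \<Rightarrow> complex) \<Rightarrow> bool" where
  "finite_blaschke n \<theta> \<longleftrightarrow> (\<exists>c as. norm c = 1 \<and> length as = n \<and> (\<forall>a\<in>set as. norm a < 1) \<and>
     ae_T (\<lambda>z. \<theta> z = c * (\<Prod>a\<leftarrow>as. (z - a) / (1 - cnj a * z))))"

text \<open>Kernel of the Toeplitz operator T_g: f in H^2 with P(gf) = 0, i.e. all
  Fourier coefficients of gf of nonnegative index vanish.\<close>
definition toeplitz_ker :: "(complex \<Rightarrow> complex) \<Rightarrow> (complex \<Rightarrow> complex) set" where
  "toeplitz_ker g = {f. H2 f \<and> (\<forall>n\<ge>0. fourier_coeff (\<lambda>z. g z * f z) n = 0)}"

definition lin_indep_T :: "(complex \<Rightarrow> complex) list \<Rightarrow> bool" where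
  "lin_indep_T fs \<longleftrightarrow> (\<forall>c :: nat \<Rightarrow> complex.
     ae_T (\<lambda>z. (\<Sum>i<length fs. c i * (fs ! i) z) = 0) \<longrightarrow> (\<forall>i<length fs. c i = 0))"

definition dim_T_eq :: "(complex \<Rightarrow> complex) set \<Rightarrow> nat \<Rightarrow> bool" where
  "dim_T_eq K d \<longleftrightarrow> (\<exists>fs. length fs = d \<and> set fs \<subseteq> K \<and> lin_indep_T fs \<and>
     (\<forall>f\<in>K. \<exists>c :: nat \<Rightarrow> complex. ae_T (\<lambda>z. f z = (\<Sum>i<d. c i * (fs ! i) z))))"

definition dim_T_infinite :: "(complex \<Rightarrow> complex) set \<Rightarrow> bool" where
  "dim_T_infinite K \<longleftrightarrow> (\<forall>d. \<exists>fs. length fs = d \<and> set fs \<subseteq> K \<and> lin_indep_T fs)"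

end

theory Submission
  imports Defs "HOL-Computational_Algebra.Fundamental_Theorem_Algebra"
begin

text \<open>
  If \<open>k\<close> is outer in \<open>H\<^sup>2\<close>, then \<open>1\<close> lies in the closure of \<open>{exp(P) k : P polynomial}\<close>: let
  \<open>Re P\<close> approximate a truncation of \<open>- ln \<bar>k\<bar>\<close>; then \<open>exp(P) k\<close> has norm close to \<open>1\<close> and, because
  \<open>\<bar>k(0)\<bar> = exp (mean of ln \<bar>k\<bar>)\<close>, also mean close to \<open>1\<close>. Consequently \<open>Q \<in> L\<^sup>2\<close> and \<open>k Q \<in> H\<^sup>1\<close>
  imply \<open>Q \<in> H\<^sup>2\<close>.

  Case \<open>N \<le> 0\<close>. Multiplying by \<open>\<theta>\<^sup>-\<^sup>N\<close> reduces to \<open>N = 0\<close>. For \<open>f\<close> in the kernel put \<open>\<phi> = f / g\<^sub>+\<close>. The fact above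
  shows \<open>Q = g\<^sub>+ cnj \<phi> \<in> z H\<^sup>2\<close>, so \<open>(1 + \<bar>\<phi>\<bar>\<^sup>2) g\<^sub>+\<^sup>2 = g\<^sub>+\<^sup>2 + f Q \<in> H\<^sup>1\<close>, and rigidity makes \<open>\<bar>\<phi>\<bar>\<^sup>2\<close> constant.
  Comparing values at \<open>0\<close> gives \<open>\<phi> = 0\<close>.

  Case \<open>N > 0\<close>. The kernel contains \<open>g\<^sub>+ q\<close> for every bounded analytic \<open>q\<close> with \<open>\<theta>\<^sup>N cnj q \<in> z H\<^sup>\<infinity>\<close>, for example for the
  backward shifts of \<open>\<theta>\<close>. A linear relation between these makes \<open>\<theta>\<close> rational, hence a finite Blaschke
  product. If \<open>\<theta>\<^sup>N\<close> is a Blaschke product of degree \<open>d\<close>, then \<open>q = z\<^sup>j / \<Prod>(1 - cnj a z)\<close>, \<open>j < d\<close>, gives \<open>d\<close> independent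
  elements; conversely, among \<open>d + 1\<close> elements some nontrivial combination is divisible by \<open>\<theta>\<^sup>N\<close> in \<open>H\<^sup>2\<close>, and the
  quotient vanishes by the case \<open>N = 0\<close>.
\<close>

section \<open>Integration on the circle\<close>

definition circ :: "real measure" where
  "circ = restrict_space lborel {0..2*pi}"

lemma space_circ [simp]: "space circ = {0..2*pi}"
  by (simp add: circ_def)

lemma finite_measure_circ: "finite_measure circ"
  unfolding circ_def by (intro finite_measure_restrict_space finite_measureI)
   (auto simp: emeasure_restrict_space)

interpretation circ: finite_measure circ
  using finite_measure_circ .

lemma measure_circ: "measure circ {0..2*pi} = 2 * pi"
  by (simp add: circ_def measure_restrict_space)

lemma borel_imp_circ_measurable:
  "f \<in> borel_measurable borel \<Longrightarrow> f \<in> borel_measurable circ"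
  unfolding circ_def by (rule measurable_restrict_space1) simp

lemma ae_T_circ: "ae_T P \<longleftrightarrow> (AE t in circ. P (cis t))"
  unfolding ae_T_def circ_def by (subst AE_restrict_space_iff) auto

lemma meas_T_circ: "meas_T f \<longleftrightarrow> (\<lambda>t. f (cis t)) \<in> borel_measurable circ"
  unfolding meas_T_def circ_def set_borel_measurable_def
  by (subst borel_measurable_restrict_space_iff) auto

lemma L1_T_circ: "L1_T f \<longleftrightarrow> integrable circ (\<lambda>t. f (cis t))"
  unfolding L1_T_def circ_def set_integrable_def
  by (subst integrable_restrict_space) auto

lemma L2_T_circ: "L2_T f \<longleftrightarrow> meas_T f \<and> integrable circ (\<lambda>t. (norm (f (cis t)))\<^sup>2)"
  unfolding L2_T_def circ_def set_integrable_def
  by (subst integrable_restrict_space) auto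

lemma fourier_coeff_circ:
  "fourier_coeff f n = (\<integral>t. f (cis t) * cis (- (of_int n * t)) \<partial>circ) / complex_of_real (2*pi)"
  unfolding fourier_coeff_def circ_def set_lebesgue_integral_def
  by (subst integral_restrict_space) auto

lemma ae_T_mp: "ae_T P \<Longrightarrow> ae_T (\<lambda>z. P z \<longrightarrow> Q z) \<Longrightarrow> ae_T Q"
  unfolding ae_T_circ by (rule AE_mp)

lemma ae_T_I: "(\<And>z. norm z = 1 \<Longrightarrow> P z) \<Longrightarrow> ae_T P"
  unfolding ae_T_circ by (intro AE_I2) auto

lemma ae_T_False: "\<not> ae_T (\<lambda>z. False)"
proof
  assume "ae_T (\<lambda>z. False)"
  then have "emeasure circ (space circ) = 0"
    unfolding ae_T_circ by (metis ae_filter_eq_bot_iff trivial_limit_def)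
  then show False
    using measure_circ by (simp add: measure_def)
qed

lemma meas_T_L1: "L1_T f \<Longrightarrow> meas_T f"
  by (auto simp: L1_T_circ meas_T_circ)

section \<open>Fourier coefficients and their algebra\<close>

lemma fourier_coeff_cong:
  assumes "meas_T f" "meas_T h" "ae_T (\<lambda>z. f z = h z)"
  shows "fourier_coeff f n = fourier_coeff h n"
proof -
  have "(\<integral>t. f (cis t) * cis (- (of_int n * t)) \<partial>circ) = (\<integral>t. h (cis t) * cis (- (of_int n * t)) \<partial>circ)"
    using assms unfolding ae_T_circ meas_T_circ
    by (intro integral_cong_AE borel_measurable_times) (auto intro!: borel_imp_circ_measurable borel_measurable_continuous_onI continuous_intros)
  then show ?thesis by (simp add: fourier_coeff_circ)
qed

lemma cis_int_measurable [measurable]: "(\<lambda>t. cis (- (of_int n * t))) \<in> borel_measurable circ"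
  by (intro borel_imp_circ_measurable borel_measurable_continuous_onI continuous_intros)

lemma integrable_circ_bounded_mult:
  fixes f h :: "real \<Rightarrow> complex"
  assumes "integrable circ f" "h \<in> borel_measurable circ" "AE t in circ. norm (h t) \<le> C"
  shows "integrable circ (\<lambda>t. h t * f t)"
proof (rule Bochner_Integration.integrable_bound)
  show "integrable circ (\<lambda>t. C * norm (f t))" using assms by simp
  show "AE t in circ. norm (h t * f t) \<le> norm (C * norm (f t))"
    using assms(3) by eventually_elim (auto simp: norm_mult abs_mult intro!: mult_right_mono)
qed (use assms in auto)

lemma integrable_fourier:
  "L1_T f \<Longrightarrow> integrable circ (\<lambda>t. f (cis t) * cis (- (of_int n * t)))"
  using integrable_circ_bounded_mult[of "\<lambda>t. f (cis t)" "\<lambda>t. cis (- (of_int n * t))" 1]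
  by (simp add: L1_T_circ cis_int_measurable mult.commute[of "f _"])

lemma L1_add: "L1_T f \<Longrightarrow> L1_T h \<Longrightarrow> L1_T (\<lambda>z. f z + h z)"
  by (simp add: L1_T_circ)
lemma L1_cmult: "L1_T f \<Longrightarrow> L1_T (\<lambda>z. c * f z)"
  by (simp add: L1_T_circ)
lemma fourier_coeff_add:
  "L1_T f \<Longrightarrow> L1_T h \<Longrightarrow> fourier_coeff (\<lambda>z. f z + h z) n = fourier_coeff f n + fourier_coeff h n"
  using integrable_fourier[of f n] integrable_fourier[of h n]
  by (simp add: fourier_coeff_circ distrib_right add_divide_distrib)

lemma fourier_coeff_diff:
  "L1_T f \<Longrightarrow> L1_T h \<Longrightarrow> fourier_coeff (\<lambda>z. f z - h z) n = fourier_coeff f n - fourier_coeff h n"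
  using integrable_fourier[of f n] integrable_fourier[of h n]
  by (simp add: fourier_coeff_circ left_diff_distrib diff_divide_distrib)

lemma fourier_coeff_cmult: "fourier_coeff (\<lambda>z. c * f z) n = c * fourier_coeff f n"
  by (simp add: fourier_coeff_circ mult.assoc)

lemma fourier_coeff_sum:
  assumes "\<And>i. i \<in> I \<Longrightarrow> L1_T (f i)"
  shows "fourier_coeff (\<lambda>z. \<Sum>i\<in>I. f i z) n = (\<Sum>i\<in>I. fourier_coeff (f i) n)"
  using assms integrable_fourier
  by (simp add: fourier_coeff_circ sum_distrib_right sum_divide_distrib Bochner_Integration.integral_sum)

lemma fourier_coeff_cnj: "fourier_coeff (\<lambda>z. cnj (f z)) n = cnj (fourier_coeff f (- n))"
  by (simp add: fourier_coeff_circ cis_cnj del: Bochner_Integration.integral_cnj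
      flip: Bochner_Integration.integral_cnj)

lemma fourier_coeff_power_mult: "fourier_coeff (\<lambda>z. z ^ j * f z) n = fourier_coeff f (n - int j)"
proof -
  have "cis t ^ j * f (cis t) * cis (- (of_int n * t)) = f (cis t) * cis (- (of_int (n - int j) * t))" for t
    by (subst mult.commute[of "cis t ^ j"])
      (simp add: Complex.DeMoivre[of t j] cis_mult mult.assoc left_diff_distrib)
  then show ?thesis unfolding fourier_coeff_circ by (simp only:)
qed

lemma meas_T_bounded_L1:
  assumes "meas_T f" "ae_T (\<lambda>z. norm (f z) \<le> C)"
  shows "L1_T f"
  using assms unfolding L1_T_circ meas_T_circ ae_T_circ
  by (intro circ.integrable_const_bound)

lemma meas_T_continuous: "continuous_on (sphere 0 1) f \<Longrightarrow> meas_T f"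
  unfolding meas_T_circ
  by (intro borel_imp_circ_measurable borel_measurable_continuous_onI
      continuous_on_compose2[of "sphere 0 1" f UNIV cis] continuous_intros) auto

lemma fourier_coeff_norm_le:
  assumes "meas_T f" "ae_T (\<lambda>z. norm (f z) \<le> C)"
  shows "norm (fourier_coeff f n) \<le> C"
proof -
  have "norm (\<integral>t. f (cis t) * cis (- (of_int n * t)) \<partial>circ)
      \<le> (\<integral>t. norm (f (cis t) * cis (- (of_int n * t))) \<partial>circ)"
    by (rule integral_norm_bound)
  also have "\<dots> \<le> (\<integral>t. C \<partial>circ)"
    using assms(2) meas_T_bounded_L1[OF assms]
    by (intro integral_mono_AE) (auto simp: norm_mult ae_T_circ L1_T_circ)
  also have "\<dots> = C * (2*pi)" using measure_circ by simp
  finally show ?thesis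
    by (simp add: fourier_coeff_circ norm_divide field_simps)
qed

lemma fourier_coeff_one: "fourier_coeff (\<lambda>z. 1) n = (if n = 0 then 1 else 0)"
proof (cases "n = 0")
  case True
  then show ?thesis using measure_circ by (simp add: fourier_coeff_circ scaleR_conv_of_real)
next
  case False
  \<comment> \<open>With c nonzero, exp (c t) / c is a primitive of the integrand, and it takes
    equal values at 0 and 2 pi.\<close>
  define c where "c = - (\<i> * of_int n)"
  have c: "c \<noteq> 0" "cis (- (of_int n * t)) = exp (c * of_real t)" for t
    using False by (auto simp: c_def cis_conv_exp algebra_simps)
  have "((\<lambda>z. exp (c * z) / c) has_field_derivative exp (c * of_real t)) (at (of_real t))" for t
    using c by (auto intro!: derivative_eq_intros)
  then have "((\<lambda>t. exp (c * of_real t) / c) has_vector_derivative exp (c * of_real t)) (at t within S)" for t S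
    using has_vector_derivative_real_field by blast
  then have "((\<lambda>t. cis (- (of_int n * t))) has_integral
      (cis (- (of_int n * (2*pi))) / c - cis (- (of_int n * 0)) / c)) {0..2*pi}"
    unfolding c(2) by (intro fundamental_theorem_of_calculus) auto
  moreover have "cis (- (of_int n * (2*pi))) = 1"
    using cis_multiple_2pi[of "of_int (-n)"] by (simp add: mult_ac)
  ultimately have "((\<lambda>t. cis (- (of_int n * t))) has_integral 0) {0..2*pi}" by simp
  moreover have "set_integrable lborel {0..2*pi} (\<lambda>t. cis (- (of_int n * t)))"
    by (intro borel_integrable_atLeastAtMost' continuous_intros)
  ultimately have "(LINT t:{0..2*pi}|lborel. cis (- (of_int n * t))) = 0"
    using set_borel_integral_eq_integral(2) by (metis integral_unique)
  then show ?thesis using False by (simp add: fourier_coeff_def)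
qed

section \<open>Square-integrable functions\<close>

lemma meas_T_add: "meas_T f \<Longrightarrow> meas_T h \<Longrightarrow> meas_T (\<lambda>z. f z + h z)"
  by (simp add: meas_T_circ)
lemma meas_T_diff: "meas_T f \<Longrightarrow> meas_T h \<Longrightarrow> meas_T (\<lambda>z. f z - h z)"
  by (simp add: meas_T_circ)
lemma meas_T_mult: "meas_T f \<Longrightarrow> meas_T h \<Longrightarrow> meas_T (\<lambda>z. f z * h z)"
  by (simp add: meas_T_circ)
lemma meas_T_divide: "meas_T f \<Longrightarrow> meas_T h \<Longrightarrow> meas_T (\<lambda>z. f z / h z)"
  by (simp add: meas_T_circ)
lemma meas_T_cnj: "meas_T f \<Longrightarrow> meas_T (\<lambda>z. cnj (f z))"
  unfolding meas_T_circ by (rule borel_measurable_continuous_on[of cnj]) (auto intro: continuous_intros)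
lemma meas_T_const: "meas_T (\<lambda>z. c)"
  by (simp add: meas_T_circ)

lemma L1_bounded_mult:
  assumes "L1_T f" "meas_T h" "ae_T (\<lambda>z. norm (h z) \<le> C)"
  shows "L1_T (\<lambda>z. h z * f z)"
  using assms unfolding L1_T_circ meas_T_circ ae_T_circ by (rule integrable_circ_bounded_mult)

section \<open>Polynomials as functions on the circle\<close>

lemma poly_bounded_circle:
  fixes p :: "complex poly"
  obtains C where "C > 0" "\<And>z. norm z = 1 \<Longrightarrow> norm (poly p z) \<le> C"
proof -
  have "compact (poly p ` sphere 0 1)"
    by (intro compact_continuous_image continuous_intros) auto
  then have "bounded (poly p ` sphere 0 1)" by (rule compact_imp_bounded)
  then show ?thesis using that by (auto simp: bounded_pos)
qed

lemma meas_T_poly: "meas_T (poly p)"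
  by (intro meas_T_continuous continuous_intros)

lemma L1_poly_mult: "L1_T f \<Longrightarrow> L1_T (\<lambda>z. poly p z * f z)"
  by (rule poly_bounded_circle[of p], rule L1_bounded_mult) (auto intro: ae_T_I meas_T_poly)

lemma L1_const: "L1_T (\<lambda>z. c)"
  by (simp add: L1_T_circ)

lemma L1_poly: "L1_T (poly p)"
  using L1_poly_mult[OF L1_const[of 1], of p] by simp

lemma L1_power_mult: "L1_T f \<Longrightarrow> L1_T (\<lambda>z. z ^ j * f z)"
  using L1_poly_mult[of f "monom 1 j"] by (simp add: poly_monom)

lemma fourier_coeff_poly_mult:
  assumes "L1_T f"
  shows "fourier_coeff (\<lambda>z. poly p z * f z) n = (\<Sum>i\<le>degree p. coeff p i * fourier_coeff f (n - int i))"
proof -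
  have "(\<lambda>z. poly p z * f z) = (\<lambda>z. \<Sum>i\<le>degree p. coeff p i * (z ^ i * f z))"
    by (simp add: poly_altdef sum_distrib_right mult.assoc)
  then show ?thesis
    using assms by (simp add: fourier_coeff_sum L1_cmult L1_power_mult fourier_coeff_cmult fourier_coeff_power_mult)
qed

lemma fourier_coeff_poly: "fourier_coeff (poly p) n = (if n < 0 then 0 else coeff p (nat n))"
proof -
  have "fourier_coeff (poly p) n = (\<Sum>i\<le>degree p. coeff p i * fourier_coeff (\<lambda>z. 1) (n - int i))"
    using fourier_coeff_poly_mult[OF L1_const[of 1], of p n] by simp
  also have "\<dots> = (\<Sum>i\<le>degree p. if i = nat n \<and> n \<ge> 0 then coeff p i else 0)"
    by (intro sum.cong) (auto simp: fourier_coeff_one)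
  also have "\<dots> = (if n < 0 then 0 else coeff p (nat n))"
    by (auto simp: sum.delta coeff_eq_0)
  finally show ?thesis .
qed

text \<open>The Fourier coefficients of a polynomial are its coefficients. This upgrades identities
  holding a.e. on the circle to identities of polynomials.\<close>

lemma poly_eq_0_if_ae:
  assumes "ae_T (\<lambda>z. poly p z = 0)"
  shows "p = 0"
proof (rule poly_eqI)
  fix n
  have "fourier_coeff (poly p) (int n) = fourier_coeff (\<lambda>z. 0) (int n)"
    using assms by (intro fourier_coeff_cong meas_T_poly meas_T_const)
  moreover have "fourier_coeff (\<lambda>z. 0) (int n) = 0" by (simp add: fourier_coeff_circ)
  ultimately show "coeff p n = coeff 0 n"
    by (simp add: fourier_coeff_poly)
qed

text \<open>The squared L^2 norm for arc length of total mass 2 pi, whereas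
  \<open>fourier_coeff\<close> divides by 2 pi; hence the factors of pi in the estimates
  below.\<close>

definition nrm2 :: "(complex \<Rightarrow> complex) \<Rightarrow> real" where
  "nrm2 f = (\<integral>t. (norm (f (cis t)))\<^sup>2 \<partial>circ)"

lemma nrm2_nonneg: "nrm2 f \<ge> 0"
  by (simp add: nrm2_def)

lemma meas_T_L2: "L2_T f \<Longrightarrow> meas_T f"
  by (simp add: L2_T_def)

lemma L2_mult_L1:
  assumes "L2_T f" "L2_T h"
  shows "L1_T (\<lambda>z. f z * h z)"
  unfolding L1_T_circ
proof (rule Bochner_Integration.integrable_bound)
  show "integrable circ (\<lambda>t. (norm (f (cis t)))\<^sup>2 + (norm (h (cis t)))\<^sup>2)"
    using assms by (simp add: L2_T_circ)
  have "norm (a * b) \<le> (norm a)\<^sup>2 + (norm b)\<^sup>2" for a b :: complex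
  proof -
    have "2 * (norm a * norm b) \<le> (norm a)\<^sup>2 + (norm b)\<^sup>2"
      using sum_squares_bound[of "norm a" "norm b"] by simp
    moreover have "norm a * norm b \<ge> 0" by simp
    ultimately show ?thesis unfolding norm_mult by linarith
  qed
  then show "AE t in circ. norm (f (cis t) * h (cis t)) \<le> norm ((norm (f (cis t)))\<^sup>2 + (norm (h (cis t)))\<^sup>2)"
    by simp
qed (use assms in \<open>auto simp: L2_T_circ meas_T_circ\<close>)

lemma L2_bounded:
  assumes "meas_T f" "ae_T (\<lambda>z. norm (f z) \<le> C)"
  shows "L2_T f"
  unfolding L2_T_circ
proof
  have "AE t in circ. norm ((norm (f (cis t)))\<^sup>2) \<le> C\<^sup>2"
    using assms(2) unfolding ae_T_circ by eventually_elim (simp add: power_mono)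
  then show "integrable circ (\<lambda>t. (norm (f (cis t)))\<^sup>2)"
    using assms(1) by (intro circ.integrable_const_bound[where B="C\<^sup>2"]) (auto simp: meas_T_circ)
qed (use assms in simp)

lemma L2_const: "L2_T (\<lambda>z. c)"
  by (rule L2_bounded[where C="norm c"]) (auto intro: meas_T_const ae_T_I)

lemma L2_L1: "L2_T f \<Longrightarrow> L1_T f"
  using L2_mult_L1[of f "\<lambda>z. 1"] L2_const by simp

lemma norm_add_sq_le: "(norm (a + b))\<^sup>2 \<le> 2 * (norm a)\<^sup>2 + 2 * (norm b)\<^sup>2"
  for a b :: "'a::real_normed_vector"
proof -
  have "(norm (a + b))\<^sup>2 \<le> (norm a + norm b)\<^sup>2"
    by (intro power_mono norm_triangle_ineq) auto
  also have "\<dots> \<le> 2 * (norm a)\<^sup>2 + 2 * (norm b)\<^sup>2"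
    using sum_squares_bound[of "norm a" "norm b"] by (simp add: power2_sum)
  finally show ?thesis .
qed

lemma L2_add:
  assumes "L2_T f" "L2_T h"
  shows "L2_T (\<lambda>z. f z + h z)" "nrm2 (\<lambda>z. f z + h z) \<le> 2 * nrm2 f + 2 * nrm2 h"
proof -
  have i: "integrable circ (\<lambda>t. 2 * (norm (f (cis t)))\<^sup>2 + 2 * (norm (h (cis t)))\<^sup>2)"
    using assms by (simp add: L2_T_circ)
  have j: "integrable circ (\<lambda>t. (norm (f (cis t) + h (cis t)))\<^sup>2)"
    by (rule Bochner_Integration.integrable_bound[OF i])
      (use assms in \<open>auto simp: L2_T_circ meas_T_circ norm_add_sq_le\<close>)
  then show "L2_T (\<lambda>z. f z + h z)"
    using assms by (auto simp: L2_T_circ intro: meas_T_add)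
  have "nrm2 (\<lambda>z. f z + h z) \<le> (\<integral>t. 2 * (norm (f (cis t)))\<^sup>2 + 2 * (norm (h (cis t)))\<^sup>2 \<partial>circ)"
    unfolding nrm2_def using i j by (intro integral_mono norm_add_sq_le)
  also have "\<dots> = 2 * nrm2 f + 2 * nrm2 h"
    using assms by (simp add: nrm2_def L2_T_circ)
  finally show "nrm2 (\<lambda>z. f z + h z) \<le> 2 * nrm2 f + 2 * nrm2 h" .
qed

lemma L2_bounded_mult:
  assumes "L2_T f" "meas_T h" "ae_T (\<lambda>z. norm (h z) \<le> C)"
  shows "L2_T (\<lambda>z. h z * f z)"
  unfolding L2_T_circ
proof
  show "meas_T (\<lambda>z. h z * f z)" using assms by (auto intro: meas_T_mult meas_T_L2)
  have i: "integrable circ (\<lambda>t. C\<^sup>2 * (norm (f (cis t)))\<^sup>2)"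
    using assms by (simp add: L2_T_circ)
  show "integrable circ (\<lambda>t. (norm (h (cis t) * f (cis t)))\<^sup>2)"
  proof (rule Bochner_Integration.integrable_bound[OF i])
    show "AE t in circ. norm ((norm (h (cis t) * f (cis t)))\<^sup>2) \<le> norm (C\<^sup>2 * (norm (f (cis t)))\<^sup>2)"
      using assms(3) unfolding ae_T_circ
      by eventually_elim (auto simp: norm_mult power_mult_distrib intro!: mult_right_mono power_mono)
  qed (use assms in \<open>auto simp: L2_T_circ meas_T_circ\<close>)
qed

lemma L2_cmult: "L2_T f \<Longrightarrow> L2_T (\<lambda>z. c * f z)"
  by (rule L2_bounded_mult[where C="norm c"]) (auto intro: meas_T_const ae_T_I)

lemma L2_diff: "L2_T f \<Longrightarrow> L2_T h \<Longrightarrow> L2_T (\<lambda>z. f z - h z)"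
  using L2_add(1)[of f "\<lambda>z. -1 * h z"] L2_cmult[of h "-1"] by simp

lemma L2_sum: "(\<And>i. i \<in> I \<Longrightarrow> L2_T (f i)) \<Longrightarrow> L2_T (\<lambda>z. \<Sum>i\<in>I. f i z)"
  by (induction I rule: infinite_finite_induct) (auto intro: L2_add L2_const)

lemma L2_cnj: "L2_T f \<Longrightarrow> L2_T (\<lambda>z. cnj (f z))"
  by (simp add: L2_T_circ meas_T_cnj)

lemma L2_poly_mult: "L2_T f \<Longrightarrow> L2_T (\<lambda>z. poly p z * f z)"
  by (rule poly_bounded_circle[of p], rule L2_bounded_mult) (auto intro: ae_T_I meas_T_poly)

lemma L2_poly: "L2_T (poly p)"
  using L2_poly_mult[OF L2_const[of 1], of p] by simp

lemma L2_cong: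
  assumes "L2_T f" "meas_T h" "ae_T (\<lambda>z. norm (h z) = norm (f z))"
  shows "L2_T h"
  unfolding L2_T_circ
proof
  show "integrable circ (\<lambda>t. (norm (h (cis t)))\<^sup>2)"
    using assms by (subst integrable_cong_AE[where g="\<lambda>t. (norm (f (cis t)))\<^sup>2"])
      (auto simp: L2_T_circ meas_T_circ ae_T_circ)
qed (use assms in simp)

lemma Cauchy_Schwarz_circ:
  assumes "L2_T f" "L2_T h"
  shows "(\<integral>t. norm (f (cis t)) * norm (h (cis t)) \<partial>circ) \<le> sqrt (nrm2 f) * sqrt (nrm2 h)"
proof -
  let ?C = "\<integral>t. norm (f (cis t)) * norm (h (cis t)) \<partial>circ"
  have i: "integrable circ (\<lambda>t. norm (f (cis t)) * norm (h (cis t)))"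
    using integrable_norm[OF L2_mult_L1[OF assms, unfolded L1_T_circ]] by (simp add: norm_mult)
  \<comment> \<open>The quadratic in x is the integral of (x |f| - |h|)^2, so it is nonnegative for
    every real x.\<close>
  have q: "0 \<le> x\<^sup>2 * nrm2 f - 2 * x * ?C + nrm2 h" for x
  proof -
    have "0 \<le> (\<integral>t. (x * norm (f (cis t)) - norm (h (cis t)))\<^sup>2 \<partial>circ)" by simp
    also have "\<dots> = (\<integral>t. x\<^sup>2 * (norm (f (cis t)))\<^sup>2 - 2 * x * (norm (f (cis t)) * norm (h (cis t))) + (norm (h (cis t)))\<^sup>2 \<partial>circ)"
      by (intro Bochner_Integration.integral_cong) (auto simp: power2_eq_square algebra_simps)
    also have "\<dots> = x\<^sup>2 * nrm2 f - 2 * x * ?C + nrm2 h"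
      using assms i by (simp add: L2_T_circ nrm2_def)
    finally show ?thesis .
  qed
  have "?C\<^sup>2 \<le> nrm2 f * nrm2 h"
  proof (cases "nrm2 f = 0")
    case True
    have "?C = 0"
    proof (rule ccontr)
      assume "?C \<noteq> 0"
      \<comment> \<open>With \<open>nrm2 f = 0\<close> the quadratic is linear in x; at this x it
        equals - nrm2 h - 2, which is negative.\<close>
      then show False using q[of "(nrm2 h + 1) / ?C"] True nrm2_nonneg[of h] by simp
    qed
    then show ?thesis using True by simp
  next
    case False
    then have "nrm2 f > 0" using nrm2_nonneg[of f] by simp
    then show ?thesis using q[of "?C / nrm2 f"] by (simp add: field_simps power2_eq_square)
  qed
  then have "?C \<le> sqrt (nrm2 f * nrm2 h)" by (rule real_le_rsqrt)
  then show ?thesis by (simp add: real_sqrt_mult)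
qed

lemma fourier_coeff_mult_le:
  assumes "L2_T f" "L2_T h"
  shows "norm (fourier_coeff (\<lambda>z. f z * h z) n) \<le> sqrt (nrm2 f) * sqrt (nrm2 h) / (2 * pi)"
proof -
  have "norm (\<integral>t. f (cis t) * h (cis t) * cis (- (of_int n * t)) \<partial>circ)
      \<le> (\<integral>t. norm (f (cis t) * h (cis t) * cis (- (of_int n * t))) \<partial>circ)"
    by (rule integral_norm_bound)
  also have "\<dots> \<le> sqrt (nrm2 f) * sqrt (nrm2 h)"
    using Cauchy_Schwarz_circ[OF assms] by (simp add: norm_mult)
  finally show ?thesis
    by (simp add: fourier_coeff_circ norm_divide divide_right_mono)
qed

text \<open>By Cauchy-Schwarz, each Fourier coefficient of a product depends continuously on one
  factor in L^2. This carries vanishing negative coefficients and values at 0 over to L^2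
  limits.\<close>

lemma fourier_coeff_mult_tendsto:
  assumes "\<And>j. L2_T (u j)" "L2_T f" "L2_T h"
    and "(\<lambda>j. nrm2 (\<lambda>z. u j z - f z)) \<longlonglongrightarrow> 0"
  shows "(\<lambda>j. fourier_coeff (\<lambda>z. u j z * h z) n) \<longlonglongrightarrow> fourier_coeff (\<lambda>z. f z * h z) n"
proof (rule LIM_zero_cancel)
  have "(\<lambda>j. sqrt (nrm2 (\<lambda>z. u j z - f z)) * sqrt (nrm2 h) / (2*pi)) \<longlonglongrightarrow> sqrt 0 * sqrt (nrm2 h) / (2*pi)"
    by (intro tendsto_intros assms) auto
  then have l: "(\<lambda>j. sqrt (nrm2 (\<lambda>z. u j z - f z)) * sqrt (nrm2 h) / (2*pi)) \<longlonglongrightarrow> 0" by simp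
  have "norm (fourier_coeff (\<lambda>z. u j z * h z) n - fourier_coeff (\<lambda>z. f z * h z) n)
     \<le> sqrt (nrm2 (\<lambda>z. u j z - f z)) * sqrt (nrm2 h) / (2*pi)" for j
  proof -
    have "fourier_coeff (\<lambda>z. u j z * h z) n - fourier_coeff (\<lambda>z. f z * h z) n
        = fourier_coeff (\<lambda>z. (u j z - f z) * h z) n"
      using assms by (simp add: left_diff_distrib fourier_coeff_diff L2_mult_L1)
    then show ?thesis
      using fourier_coeff_mult_le[of "\<lambda>z. u j z - f z" h n] assms
      by (metis L2_diff)
  qed
  then show "(\<lambda>j. fourier_coeff (\<lambda>z. u j z * h z) n - fourier_coeff (\<lambda>z. f z * h z) n) \<longlonglongrightarrow> 0"
    by (intro Lim_null_comparison[OF _ l] always_eventually allI)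
qed

section \<open>Approximation by polynomials\<close>

lemma mult_cnj_circle: "norm z = 1 \<Longrightarrow> z * cnj z = 1"
  by (simp flip: complex_norm_square)

text \<open>On the circle \<open>a * cnj z ^ m\<close> has the same real part as its conjugate
  \<open>cnj a * z ^ m\<close>, so negative powers can be traded for positive ones. The induction
  peels off the lowest coefficient of S, which carries the highest power of
  \<open>cnj z\<close>.\<close>

lemma Re_cnj_power_mult_poly:
  "\<exists>R. \<forall>z. norm z = 1 \<longrightarrow> Re (cnj z ^ d * poly S z) = Re (poly R z)"
proof (induction d arbitrary: S)
  case 0
  show ?case by auto
next
  case (Suc d)
  obtain a S' where S: "S = pCons a S'" by (cases S) auto
  obtain R where R: "\<And>z. norm z = 1 \<Longrightarrow> Re (cnj z ^ d * poly S' z) = Re (poly R z)"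
    using Suc by blast
  have "Re (cnj z ^ Suc d * poly S z) = Re (poly (R + monom (cnj a) (Suc d)) z)" if "norm z = 1" for z
  proof -
    have "cnj z ^ Suc d * poly S z = a * cnj z ^ Suc d + cnj z ^ d * (z * cnj z) * poly S' z"
      by (simp add: S algebra_simps)
    also have "\<dots> = cnj (poly (monom (cnj a) (Suc d)) z) + cnj z ^ d * poly S' z"
      by (simp add: mult_cnj_circle[OF that] poly_monom)
    finally have "cnj z ^ Suc d * poly S z = \<dots>" .
    then show ?thesis using R[OF that] by simp
  qed
  then show ?case by blast
qed

text \<open>Since \<open>cnj z\<close> is 1/z on the circle, reversing and conjugating the
  coefficients turns the conjugate of a polynomial into a polynomial, up to a power of z.\<close>

lemma poly_reflect_cnj:
  assumes "norm z = 1"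
  shows "poly (reflect_poly (map_poly cnj p)) z = z ^ degree p * cnj (poly p z)"
proof -
  have "z \<noteq> 0" "inverse z = cnj z"
    using assms mult_cnj_circle[OF assms] by (auto intro: inverse_unique)
  moreover have "degree (map_poly cnj p) = degree p" by (rule degree_map_poly) auto
  ultimately show ?thesis by (simp add: poly_reflect_poly_nz)
qed

text \<open>Uses 2 Re P Re Q = Re (P Q) + Re (P cnj Q), where the second term is again the real part
  of a polynomial on the circle.\<close>

lemma Re_poly_mult_Re_poly:
  "\<exists>R. \<forall>z. norm z = 1 \<longrightarrow> Re (poly P z) * Re (poly Q z) = Re (poly R z)"
proof -
  obtain R where R: "\<And>z. norm z = 1 \<Longrightarrow>
      Re (cnj z ^ degree Q * poly (P * reflect_poly (map_poly cnj Q)) z) = Re (poly R z)"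
    using Re_cnj_power_mult_poly by blast
  have "Re (poly P z) * Re (poly Q z) = Re (poly (smult (1/2) (P * Q + R)) z)" if "norm z = 1" for z
  proof -
    have "cnj z ^ degree Q * poly (P * reflect_poly (map_poly cnj Q)) z
        = (z * cnj z) ^ degree Q * (poly P z * cnj (poly Q z))"
      using that by (simp add: poly_reflect_cnj power_mult_distrib)
    then have "cnj z ^ degree Q * poly (P * reflect_poly (map_poly cnj Q)) z = poly P z * cnj (poly Q z)"
      by (simp add: mult_cnj_circle[OF that])
    then have "Re (poly R z) = Re (poly P z * cnj (poly Q z))" using R[OF that] by (simp only:)
    then show ?thesis by simp
  qed
  then show ?thesis by blast
qed

text \<open>Translates the approximants supplied by Stone-Weierstrass into real parts of analytic
  polynomials.\<close>

lemma real_polynomial_function_circle: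
  fixes p :: "complex \<Rightarrow> real"
  assumes "real_polynomial_function p"
  shows "\<exists>P. \<forall>z. norm z = 1 \<longrightarrow> p z = Re (poly P z)"
  using assms
proof induction
  case (linear f)
  \<comment> \<open>A real-linear f is determined by its values at 1 and i: Re ((f 1 - i f i) z) = f
    1 Re z + f i Im z.\<close>
  have "f z = Re (poly [:0, of_real (f 1) - \<i> * of_real (f \<i>):] z)" for z
  proof -
    have "z = Re z *\<^sub>R 1 + Im z *\<^sub>R \<i>"
      by (simp add: complex_eq_iff)
    then have "f z = f (Re z *\<^sub>R 1 + Im z *\<^sub>R \<i>)" by (rule arg_cong)
    also have "\<dots> = Re z * f 1 + Im z * f \<i>"
      using linear by (simp only: linear_add linear_scale bounded_linear.linear) simp
    finally show ?thesis by simp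
  qed
  then show ?case by blast
next
  case (const c)
  show ?case by (rule exI[of _ "[:of_real c:]"]) simp
next
  case (add f g)
  then obtain P Q where "\<forall>z. norm z = 1 \<longrightarrow> f z = Re (poly P z)" "\<forall>z. norm z = 1 \<longrightarrow> g z = Re (poly Q z)"
    by blast
  then show ?case by (intro exI[of _ "P + Q"]) simp
next
  case (mult f g)
  then show ?case using Re_poly_mult_Re_poly by metis
qed

lemma Arg2pi_cis: "0 \<le> t \<Longrightarrow> t < 2 * pi \<Longrightarrow> Arg2pi (cis t) = t"
  by (rule Arg2pi_unique[of 1]) (auto simp: cis_conv_exp)

text \<open>A measurable function is an a.e. limit of continuous ones; these are truncated, made to
  close up on the circle, and approximated uniformly by Stone-Weierstrass. The bound independent of
  n prepares dominated convergence.\<close>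

lemma bounded_measurable_limit_Re_poly:
  fixes w :: "real \<Rightarrow> real"
  assumes w: "w \<in> borel_measurable circ" and C: "\<And>t. \<bar>w t\<bar> \<le> C"
  obtains P :: "nat \<Rightarrow> complex poly" where
    "\<And>n z. norm z = 1 \<Longrightarrow> \<bar>Re (poly (P n) z)\<bar> \<le> C + 1"
    "AE t in circ. (\<lambda>n. Re (poly (P n) (cis t))) \<longlonglongrightarrow> w t"
proof -
  have "(\<lambda>t. indicator {0..2*pi} t *\<^sub>R w t) \<in> borel_measurable lborel"
    using w unfolding circ_def by (subst (asm) borel_measurable_restrict_space_iff) auto
  then have "(\<lambda>t. indicator {0..2*pi} t *\<^sub>R w t) \<in> borel_measurable lebesgue"
    by (rule measurable_completion)
  then have "(\<lambda>t. indicator {0..2*pi} t *\<^sub>R w t) measurable_on UNIV"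
    by (rule lebesgue_measurable_imp_measurable_on_real) auto
  then obtain N G where N: "negligible N" and G: "\<And>n. continuous_on UNIV (G n)"
    and lim: "\<And>t. t \<notin> N \<Longrightarrow> (\<lambda>n. G n t) \<longlonglongrightarrow> indicator {0..2*pi} t *\<^sub>R w t"
    unfolding measurable_on_def by auto
  have C0: "C \<ge> 0" using C[of 0] by linarith
  define K where "K = (\<lambda>n t. max (-C) (min C (G n t)))"
  have K: "continuous_on UNIV (K n)" "\<bar>K n t\<bar> \<le> C" for n t
    unfolding K_def using G C0 by (auto intro!: continuous_intros)
  \<comment> \<open>\<open>Arg2pi\<close> jumps at z = 1. The last factor forces the value 0 there,
    which restores continuity, and at any other point it equals 1 for all large n.\<close>
  define V where "V = (\<lambda>n z. K n (Arg2pi z) * min 1 (real n * norm (z - 1)))"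
  have Vb: "\<bar>V n z\<bar> \<le> C * (real n * norm (z - 1))" "\<bar>V n z\<bar> \<le> C" for n z
  proof -
    have "\<bar>V n z\<bar> = \<bar>K n (Arg2pi z)\<bar> * min 1 (real n * norm (z - 1))"
      by (simp add: V_def abs_mult)
    then show "\<bar>V n z\<bar> \<le> C * (real n * norm (z - 1))" "\<bar>V n z\<bar> \<le> C"
      using mult_mono[OF K(2)[of n "Arg2pi z"], of "min 1 (real n * norm (z - 1))" "real n * norm (z - 1)"]
        mult_mono[OF K(2)[of n "Arg2pi z"], of "min 1 (real n * norm (z - 1))" 1] C0 by auto
  qed
  have Vc: "continuous_on (sphere 0 1) (V n)" for n
    unfolding continuous_on_eq_continuous_within
  proof
    fix z :: complex assume z: "z \<in> sphere 0 1"
    show "continuous (at z within sphere 0 1) (V n)"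
    proof (cases "z = 1")
      case True
      have "((\<lambda>x. C * (real n * norm (x - 1))) \<longlongrightarrow> C * (real n * norm (z - 1))) (at z within sphere 0 1)"
        by (intro tendsto_intros)
      then have "(V n \<longlongrightarrow> 0) (at z within sphere 0 1)"
        using True Vb(1) by (intro Lim_null_comparison[of "V n" "\<lambda>x. C * (real n * norm (x - 1))"]) auto
      moreover have "V n z = 0" using True by (simp add: V_def)
      ultimately show ?thesis by (simp add: continuous_within)
    next
      case False
      have "z \<notin> \<real>\<^sub>\<ge>\<^sub>0"
        using False z by (auto elim!: nonneg_Reals_cases)
      then have A: "continuous (at z) Arg2pi" by (rule continuous_at_Arg2pi)
      have "continuous (at z) (\<lambda>x. K n (Arg2pi x))"
        using K(1)[of n] A by (intro continuous_at_compose[unfolded o_def, of z Arg2pi "K n"])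
          (auto simp: continuous_on_eq_continuous_at)
      then have "continuous (at z) (V n)"
        unfolding V_def by (intro continuous_intros)
      then show ?thesis by (rule continuous_at_imp_continuous_at_within)
    qed
  qed
  have "\<exists>P. \<forall>z. norm z = 1 \<longrightarrow> \<bar>V n z - Re (poly P z)\<bar> < 1 / (real n + 1)" for n
  proof -
    obtain p where p: "real_polynomial_function p" "\<And>z. z \<in> sphere 0 1 \<Longrightarrow> \<bar>V n z - p z\<bar> < 1 / (real n + 1)"
      using Stone_Weierstrass_real_polynomial_function[OF compact_sphere Vc, of "1 / (real n + 1)" n] by auto
    obtain P where "\<And>z. norm z = 1 \<Longrightarrow> p z = Re (poly P z)"
      using real_polynomial_function_circle[OF p(1)] by blast
    then show ?thesis using p(2) by (intro exI[of _ P]) auto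
  qed
  then obtain P where P: "\<And>n z. norm z = 1 \<Longrightarrow> \<bar>V n z - Re (poly (P n) z)\<bar> < 1 / (real n + 1)"
    by metis
  show ?thesis
  proof
    fix n and z :: complex assume z: "norm z = 1"
    have "1 / (real n + 1) \<le> 1" by simp
    then show "\<bar>Re (poly (P n) z)\<bar> \<le> C + 1" using P[OF z, of n] Vb(2)[of n z] by linarith
  next
    \<comment> \<open>The endpoints are discarded as well: \<open>cis t\<close> is 1 there, where V
      vanishes for every n.\<close>
    have "AE t in lborel. t \<notin> N \<union> {0, 2*pi}"
    proof -
      have "negligible (N \<union> {0, 2*pi})" using N by (intro negligible_Un) auto
      then have "AE t in lebesgue. t \<notin> N \<union> {0, 2*pi}"
        unfolding negligible_iff_null_sets by (rule AE_not_in)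
      then show ?thesis by (simp add: AE_completion_iff)
    qed
    then have "AE t in circ. t \<notin> N \<union> {0, 2*pi}"
      unfolding circ_def by (subst AE_restrict_space_iff) auto
    moreover have "AE t in circ. t \<in> space circ" by (rule AE_space)
    ultimately show "AE t in circ. (\<lambda>n. Re (poly (P n) (cis t))) \<longlonglongrightarrow> w t"
    proof eventually_elim
      case (elim t)
      then have t: "0 < t" "t < 2*pi" "t \<notin> N" by auto
      have "cis t \<noteq> 1"
        using Arg2pi_cis[of t] Arg2pi_cis[of 0] t by auto
      then have d: "norm (cis t - 1) > 0" by simp
      have "(\<lambda>n. G n t) \<longlonglongrightarrow> w t" using lim[OF t(3)] t by simp
      then have "(\<lambda>n. K n t) \<longlonglongrightarrow> max (-C) (min C (w t))"
        unfolding K_def by (intro tendsto_intros)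
      moreover have "max (-C) (min C (w t)) = w t" using C[of t] by (simp add: abs_le_iff)
      ultimately have Kl: "(\<lambda>n. K n t) \<longlonglongrightarrow> w t" by simp
      obtain n0 :: nat where n0: "1 / norm (cis t - 1) < real n0" using reals_Archimedean2 by blast
      have "min 1 (real n * norm (cis t - 1)) = 1" if "n \<ge> n0" for n
      proof -
        have "1 / norm (cis t - 1) \<le> real n" using n0 that by (meson less_imp_le of_nat_mono order_trans)
        then show ?thesis using d by (simp add: field_simps)
      qed
      then have "\<forall>n\<ge>n0. K n t = V n (cis t)"
        using Arg2pi_cis[of t] t by (simp add: V_def)
      then have "(\<lambda>n. V n (cis t)) \<longlonglongrightarrow> w t"
        by (intro Lim_transform_eventually[OF Kl]) (auto simp: eventually_sequentially)
      moreover have "(\<lambda>n. V n (cis t) - Re (poly (P n) (cis t))) \<longlonglongrightarrow> 0"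
      proof (rule Lim_null_comparison)
        show "\<forall>\<^sub>F n in sequentially. norm (V n (cis t) - Re (poly (P n) (cis t))) \<le> 1 / (real n + 1)"
          using P[of "cis t"] by (intro always_eventually) (auto simp: less_imp_le)
        show "(\<lambda>n. 1 / (real n + 1)) \<longlonglongrightarrow> 0"
          using LIMSEQ_inverse_real_of_nat by (simp add: inverse_eq_divide add.commute)
      qed
      ultimately show ?case using tendsto_diff by fastforce
    qed
  qed
qed

lemma nrm2_minus_commute: "nrm2 (\<lambda>z. f z - h z) = nrm2 (\<lambda>z. h z - f z)"
  by (simp add: nrm2_def norm_minus_commute)

text \<open>First f is truncated at height m, then the bounded real and imaginary parts are
  approximated separately. Each error is below e/4, since \<open>nrm2\<close> of a sum is at most
  twice the sum of the \<open>nrm2\<close>.\<close>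

lemma L2_approx_trig:
  assumes f: "L2_T f" and e: "e > 0"
  obtains P Q where "nrm2 (\<lambda>z. f z - (of_real (Re (poly P z)) + \<i> * of_real (Re (poly Q z)))) < e"
proof -
  have fm [measurable]: "(\<lambda>t. f (cis t)) \<in> borel_measurable circ" using f by (simp add: L2_T_circ meas_T_circ)
  define F where "F = (\<lambda>(m::nat) z. if norm (f z) \<le> real m then f z else 0)"
  have Fmeas [measurable]: "(\<lambda>t. F m (cis t)) \<in> borel_measurable circ" for m
    unfolding F_def by measurable
  have Fb: "norm (F m z) \<le> real m" for m z by (simp add: F_def)
  have "(\<lambda>m. \<integral>t. (norm (f (cis t) - F m (cis t)))\<^sup>2 \<partial>circ) \<longlonglongrightarrow> (\<integral>t. 0 \<partial>circ)"
  proof (rule integral_dominated_convergence[where w="\<lambda>t. (norm (f (cis t)))\<^sup>2"])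
    show "AE t in circ. (\<lambda>m. (norm (f (cis t) - F m (cis t)))\<^sup>2) \<longlonglongrightarrow> 0"
    proof (rule AE_I2)
      fix t
      obtain m0 :: nat where "norm (f (cis t)) < real m0" using reals_Archimedean2 by blast
      then have "\<forall>m\<ge>m0. 0 = (norm (f (cis t) - F m (cis t)))\<^sup>2"
        by (auto simp: F_def)
      then show "(\<lambda>m. (norm (f (cis t) - F m (cis t)))\<^sup>2) \<longlonglongrightarrow> 0"
        by (intro Lim_transform_eventually[OF tendsto_const]) (auto simp: eventually_sequentially)
    qed
    show "AE t in circ. norm ((norm (f (cis t) - F m (cis t)))\<^sup>2) \<le> (norm (f (cis t)))\<^sup>2" for m
      by (simp add: F_def)
  qed (use f in \<open>auto simp: L2_T_circ\<close>)
  then have "(\<lambda>m. nrm2 (\<lambda>z. f z - F m z)) \<longlonglongrightarrow> 0" by (simp add: nrm2_def)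
  then have "\<forall>\<^sub>F m in sequentially. nrm2 (\<lambda>z. f z - F m z) < e / 4"
    using e by (intro order_tendstoD(2)) auto
  then obtain m where m: "nrm2 (\<lambda>z. f z - F m z) < e / 4"
    by (auto simp: eventually_sequentially)
  have ri: "\<bar>Re (F m (cis t))\<bar> \<le> real m" "\<bar>Im (F m (cis t))\<bar> \<le> real m" for t
    using Fb[of m "cis t"] abs_Re_le_cmod[of "F m (cis t)"] abs_Im_le_cmod[of "F m (cis t)"] by linarith+
  have mri: "(\<lambda>t. Re (F m (cis t))) \<in> borel_measurable circ" "(\<lambda>t. Im (F m (cis t))) \<in> borel_measurable circ"
    by measurable
  obtain P where
    P: "\<And>n z. norm z = 1 \<Longrightarrow> \<bar>Re (poly (P n) z)\<bar> \<le> real m + 1"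
      "AE t in circ. (\<lambda>n. Re (poly (P n) (cis t))) \<longlonglongrightarrow> Re (F m (cis t))"
    by (rule bounded_measurable_limit_Re_poly[OF mri(1) ri(1)]) blast
  obtain Q where
    Q: "\<And>n z. norm z = 1 \<Longrightarrow> \<bar>Re (poly (Q n) z)\<bar> \<le> real m + 1"
      "AE t in circ. (\<lambda>n. Re (poly (Q n) (cis t))) \<longlonglongrightarrow> Im (F m (cis t))"
    by (rule bounded_measurable_limit_Re_poly[OF mri(2) ri(2)]) blast
  define T where "T = (\<lambda>n z. of_real (Re (poly (P n) z)) + \<i> * of_real (Re (poly (Q n) z)))"
  have [measurable]: "(\<lambda>t. poly p (cis t)) \<in> borel_measurable circ" for p
    using meas_T_poly by (simp add: meas_T_circ)
  have Tmeas [measurable]: "(\<lambda>t. T n (cis t)) \<in> borel_measurable circ" for n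
    unfolding T_def by measurable
  have Tb: "norm (T n z) \<le> 2 * (real m + 1)" if "norm z = 1" for n z
  proof -
    have "norm (T n z) \<le> \<bar>Re (poly (P n) z)\<bar> + \<bar>Re (poly (Q n) z)\<bar>"
      unfolding T_def by (rule order_trans[OF norm_triangle_ineq]) (simp add: norm_mult)
    also have "\<dots> \<le> (real m + 1) + (real m + 1)"
      by (intro add_mono P(1) Q(1) that)
    finally show ?thesis by simp
  qed
  have "(\<lambda>n. \<integral>t. (norm (F m (cis t) - T n (cis t)))\<^sup>2 \<partial>circ) \<longlonglongrightarrow> (\<integral>t. 0 \<partial>circ)"
  proof (rule integral_dominated_convergence[where w="\<lambda>t. (3 * real m + 2)\<^sup>2"])
    show "AE t in circ. (\<lambda>n. (norm (F m (cis t) - T n (cis t)))\<^sup>2) \<longlonglongrightarrow> 0"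
      using P(2) Q(2)
    proof eventually_elim
      case (elim t)
      have "(\<lambda>n. T n (cis t)) \<longlonglongrightarrow> of_real (Re (F m (cis t))) + \<i> * of_real (Im (F m (cis t)))"
        unfolding T_def by (intro tendsto_intros elim)
      then have "(\<lambda>n. T n (cis t)) \<longlonglongrightarrow> F m (cis t)" by (simp flip: complex_eq)
      then have "(\<lambda>n. (norm (F m (cis t) - T n (cis t)))\<^sup>2) \<longlonglongrightarrow> (norm (F m (cis t) - F m (cis t)))\<^sup>2"
        by (intro tendsto_intros)
      then show ?case by simp
    qed
    show "AE t in circ. norm ((norm (F m (cis t) - T n (cis t)))\<^sup>2) \<le> (3 * real m + 2)\<^sup>2" for n
    proof (rule AE_I2)
      fix t
      have "norm (F m (cis t) - T n (cis t)) \<le> 3 * real m + 2"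
        using norm_triangle_ineq4[of "F m (cis t)" "T n (cis t)"] Fb[of m "cis t"] Tb[of "cis t" n] by simp
      then show "norm ((norm (F m (cis t) - T n (cis t)))\<^sup>2) \<le> (3 * real m + 2)\<^sup>2"
        by (simp add: power_mono)
    qed
  qed auto
  then have "(\<lambda>n. nrm2 (\<lambda>z. F m z - T n z)) \<longlonglongrightarrow> 0" by (simp add: nrm2_def)
  then have "\<forall>\<^sub>F n in sequentially. nrm2 (\<lambda>z. F m z - T n z) < e / 4"
    using e by (intro order_tendstoD(2)) auto
  then obtain n where n: "nrm2 (\<lambda>z. F m z - T n z) < e / 4"
    by (auto simp: eventually_sequentially)
  have LF: "L2_T (F m)" by (rule L2_bounded[where C="real m"]) (use Fb in \<open>auto simp: meas_T_circ intro: ae_T_I\<close>)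
  have LT: "L2_T (T n)" by (rule L2_bounded[where C="2 * (real m + 1)"]) (use Tb in \<open>auto simp: meas_T_circ intro: ae_T_I\<close>)
  have "nrm2 (\<lambda>z. (f z - F m z) + (F m z - T n z)) \<le> 2 * nrm2 (\<lambda>z. f z - F m z) + 2 * nrm2 (\<lambda>z. F m z - T n z)"
    by (intro L2_add L2_diff f LF LT)
  then have "nrm2 (\<lambda>z. f z - T n z) < e" using m n by simp
  then show ?thesis using that unfolding T_def by blast
qed

section \<open>Hardy spaces: density of polynomials, products, values at the origin\<close>

lemma H2_L2: "H2 f \<Longrightarrow> L2_T f" by (simp add: H2_def)
lemma H2_L1: "H2 f \<Longrightarrow> L1_T f" by (simp add: H2_def L2_L1)
lemma H2_H1: "H2 f \<Longrightarrow> H1 f" by (simp add: H2_def H1_def L2_L1)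

lemma H1_poly_mult:
  assumes "H1 u"
  shows "H1 (\<lambda>z. poly p z * u z)"
    and "fourier_coeff (\<lambda>z. poly p z * u z) 0 = poly p 0 * fourier_coeff u 0"
proof -
  show "H1 (\<lambda>z. poly p z * u z)"
    using assms by (auto simp: H1_def L1_poly_mult fourier_coeff_poly_mult)
  have "fourier_coeff (\<lambda>z. poly p z * u z) 0 = (\<Sum>i\<le>degree p. coeff p i * fourier_coeff u (0 - int i))"
    using assms by (simp add: H1_def fourier_coeff_poly_mult)
  also have "\<dots> = (\<Sum>i\<le>degree p. if i = 0 then coeff p 0 * fourier_coeff u 0 else 0)"
    using assms by (intro sum.cong) (auto simp: H1_def)
  also have "\<dots> = poly p 0 * fourier_coeff u 0"
    by (simp add: poly_0_coeff_0)
  finally show "fourier_coeff (\<lambda>z. poly p z * u z) 0 = poly p 0 * fourier_coeff u 0" .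
qed

lemma H2_poly: "H2 (poly p)"
  by (simp add: H2_def L2_poly fourier_coeff_poly)

lemma H2_diff: "H2 f \<Longrightarrow> H2 h \<Longrightarrow> H2 (\<lambda>z. f z - h z)"
  by (simp add: H2_def L2_diff fourier_coeff_diff L2_L1)
lemma H2_cmult: "H2 f \<Longrightarrow> H2 (\<lambda>z. c * f z)"
  by (simp add: H2_def L2_cmult fourier_coeff_cmult)
lemma H2_sum: "(\<And>i. i \<in> I \<Longrightarrow> H2 (f i)) \<Longrightarrow> H2 (\<lambda>z. \<Sum>i\<in>I. f i z)"
  by (simp add: H2_def L2_sum fourier_coeff_sum L2_L1)
lemma H1_add: "H1 f \<Longrightarrow> H1 h \<Longrightarrow> H1 (\<lambda>z. f z + h z)"
  by (simp add: H1_def L1_add fourier_coeff_add)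

text \<open>Write an L^2 trigonometric approximant of f as \<open>p + cnj q\<close> with q(0) = 0.
  Then f - p lies in H^2 and is orthogonal to \<open>cnj q\<close>, so by Pythagoras dropping
  \<open>cnj q\<close> does not increase the error.\<close>

lemma H2_approx_poly:
  assumes f: "H2 f" and e: "e > 0"
  obtains p where "nrm2 (\<lambda>z. f z - poly p z) < e"
proof -
  obtain P Q where PQ: "nrm2 (\<lambda>z. f z - (of_real (Re (poly P z)) + \<i> * of_real (Re (poly Q z)))) < e"
    using L2_approx_trig[OF H2_L2[OF f] e] .
  \<comment> \<open>Re P + i Re Q = (P + i Q)/2 + cnj ((P - i Q)/2). The constant term of R = (P - i
    Q)/2 is moved to p, which makes q vanish at 0.\<close>
  define R where "R = smult (1/2) (P - smult \<i> Q)"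
  define q where "q = R - [:coeff R 0:]"
  define p where "p = smult (1/2) (P + smult \<i> Q) + [:cnj (coeff R 0):]"
  define u where "u = (\<lambda>z. f z - poly p z)"
  have T: "of_real (Re (poly P z)) + \<i> * of_real (Re (poly Q z)) = poly p z + cnj (poly q z)" for z
    by (simp add: p_def q_def R_def complex_eq_iff field_simps)
  have u: "H2 u" unfolding u_def by (intro H2_diff f H2_poly)
  have lu: "L2_T u" using u by (rule H2_L2)
  have lq: "L2_T (poly q)" by (rule L2_poly)
  have iq: "integrable circ (\<lambda>t. Re (poly q (cis t) * u (cis t)))"
    using L1_poly_mult[OF H2_L1[OF u], of q] unfolding L1_T_circ by (rule integrable_Re)
  have "poly q 0 = 0" by (simp add: q_def poly_0_coeff_0)
  then have "fourier_coeff (\<lambda>z. poly q z * u z) 0 = 0"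
    using H1_poly_mult(2)[OF H2_H1[OF u], of q] by simp
  then have "(\<integral>t. poly q (cis t) * u (cis t) \<partial>circ) = 0" by (simp add: fourier_coeff_circ)
  then have z: "(\<integral>t. Re (poly q (cis t) * u (cis t)) \<partial>circ) = 0"
    using L1_poly_mult[OF H2_L1[OF u], of q] by (subst integral_Re) (simp_all add: L1_T_circ)
  have "nrm2 (\<lambda>z. u z - cnj (poly q z)) = (\<integral>t. (norm (u (cis t)))\<^sup>2 + (norm (poly q (cis t)))\<^sup>2 - 2 * Re (poly q (cis t) * u (cis t)) \<partial>circ)"
    unfolding nrm2_def
    by (intro Bochner_Integration.integral_cong) (auto simp: cmod_power2 power2_diff power2_sum)
  also have "\<dots> = nrm2 u + nrm2 (poly q)"
    using lu lq iq z by (simp add: L2_T_circ nrm2_def del: times_complex.sel)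
  finally have "nrm2 u \<le> nrm2 (\<lambda>z. u z - cnj (poly q z))" using nrm2_nonneg[of "poly q"] by simp
  moreover have "(\<lambda>z. u z - cnj (poly q z)) = (\<lambda>z. f z - (of_real (Re (poly P z)) + \<i> * of_real (Re (poly Q z))))"
    unfolding T u_def by auto
  ultimately have "nrm2 u < e" using PQ by simp
  then show ?thesis using that unfolding u_def by blast
qed

text \<open>Coefficient 0 is the value of the analytic extension at the origin, so the second claim
  is multiplicativity of that evaluation. Both claims are known for a polynomial times h and pass to
  the limit as polynomials approach f in L^2.\<close>

lemma H2_mult:
  assumes f: "H2 f" and h: "H2 h"
  shows "H1 (\<lambda>z. f z * h z)"
    and "fourier_coeff (\<lambda>z. f z * h z) 0 = fourier_coeff f 0 * fourier_coeff h 0"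
proof -
  have "\<exists>p. nrm2 (\<lambda>z. f z - poly p z) < 1 / (real j + 1)" for j
    using H2_approx_poly[OF f, of "1 / (real j + 1)"] by auto
  then obtain p where p: "\<And>j. nrm2 (\<lambda>z. f z - poly (p j) z) < 1 / (real j + 1)" by metis
  have "(\<lambda>j. nrm2 (\<lambda>z. f z - poly (p j) z)) \<longlonglongrightarrow> 0"
  proof (rule Lim_null_comparison)
    show "\<forall>\<^sub>F j in sequentially. norm (nrm2 (\<lambda>z. f z - poly (p j) z)) \<le> 1 / (real j + 1)"
      using p nrm2_nonneg by (intro always_eventually) (auto simp: less_imp_le)
    show "(\<lambda>n. 1 / (real n + 1)) \<longlonglongrightarrow> 0"
      using LIMSEQ_inverse_real_of_nat by (simp add: inverse_eq_divide add.commute)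
  qed
  then have l: "(\<lambda>j. nrm2 (\<lambda>z. poly (p j) z - f z)) \<longlonglongrightarrow> 0"
    by (subst nrm2_minus_commute)
  have lim: "(\<lambda>j. fourier_coeff (\<lambda>z. poly (p j) z * h z) n) \<longlonglongrightarrow> fourier_coeff (\<lambda>z. f z * h z) n" for n
    by (rule fourier_coeff_mult_tendsto[OF L2_poly H2_L2[OF f] H2_L2[OF h] l])
  have lim1: "(\<lambda>j. fourier_coeff (\<lambda>z. poly (p j) z * 1) 0) \<longlonglongrightarrow> fourier_coeff (\<lambda>z. f z * 1) 0"
    by (rule fourier_coeff_mult_tendsto[OF L2_poly H2_L2[OF f] L2_const l])
  have "fourier_coeff (\<lambda>z. f z * h z) n = 0" if "n < 0" for n
    using lim[of n] that H1_poly_mult(1)[OF H2_H1[OF h]] by (simp add: H1_def LIMSEQ_const_iff)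
  then show "H1 (\<lambda>z. f z * h z)"
    using f h by (simp add: H1_def L2_mult_L1 H2_def)
  have "(\<lambda>j. fourier_coeff (\<lambda>z. poly (p j) z * h z) 0) \<longlonglongrightarrow> fourier_coeff f 0 * fourier_coeff h 0"
    using lim1 unfolding H1_poly_mult(2)[OF H2_H1[OF h]]
    by (intro tendsto_intros) (simp add: fourier_coeff_poly poly_0_coeff_0)
  then show "fourier_coeff (\<lambda>z. f z * h z) 0 = fourier_coeff f 0 * fourier_coeff h 0"
    using lim LIMSEQ_unique by blast
qed

lemma H1_exp_poly_mult:
  assumes "H1 u"
  shows "H1 (\<lambda>z. exp (poly P z) * u z)"
    and "fourier_coeff (\<lambda>z. exp (poly P z) * u z) 0 = exp (poly P 0) * fourier_coeff u 0"
proof -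
  \<comment> \<open>Partial sums of the exponential series of P: polynomials converging pointwise to
    exp P, and bounded on the circle by exp C once C bounds |P| there.\<close>
  define q where "q = (\<lambda>n. \<Sum>k<n. smult (1 / fact k) (P ^ k))"
  have q: "poly (q n) z = (\<Sum>k<n. poly P z ^ k /\<^sub>R fact k)" for n z
    by (simp add: q_def poly_sum scaleR_conv_of_real divide_inverse mult.commute)
  have ql: "(\<lambda>n. poly (q n) z) \<longlonglongrightarrow> exp (poly P z)" for z
    unfolding q using exp_converges[of "poly P z"] by (simp add: sums_def)
  have qb: "norm (poly (q n) z) \<le> exp (norm (poly P z))" for n z
  proof -
    have "norm (poly (q n) z) \<le> (\<Sum>k<n. norm (poly P z) ^ k /\<^sub>R fact k)"
      unfolding q by (rule order_trans[OF norm_sum]) (simp add: norm_power)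
    also have "\<dots> \<le> exp (norm (poly P z))"
      unfolding sums_unique[OF exp_converges[of "norm (poly P z)"]]
      by (intro sum_le_suminf sums_summable[OF exp_converges]) auto
    finally show ?thesis .
  qed
  obtain C where C: "C > 0" "\<And>z. norm z = 1 \<Longrightarrow> norm (poly P z) \<le> C"
    by (rule poly_bounded_circle[of P]) blast
  have u: "L1_T u" using assms by (simp add: H1_def)
  have eb: "norm (exp (poly P z)) \<le> exp C" if "norm z = 1" for z
    using C(2)[OF that] norm_exp[of "poly P z"] by (meson exp_le_cancel_iff order_trans)
  have em: "meas_T (\<lambda>z. exp (poly P z))" by (intro meas_T_continuous continuous_intros)
  have L: "L1_T (\<lambda>z. exp (poly P z) * u z)"
    using eb by (intro L1_bounded_mult[where C="exp C"] u em ae_T_I)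
  have [measurable]: "(\<lambda>t. poly p (cis t)) \<in> borel_measurable circ" for p
    using meas_T_poly by (simp add: meas_T_circ)
  have [measurable]: "(\<lambda>t. exp (poly P (cis t))) \<in> borel_measurable circ"
    using em by (simp add: meas_T_circ)
  have [measurable]: "(\<lambda>t. u (cis t)) \<in> borel_measurable circ"
    using meas_T_L1[OF u] by (simp add: meas_T_circ)
  have lim: "(\<lambda>j. fourier_coeff (\<lambda>z. poly (q j) z * u z) n) \<longlonglongrightarrow> fourier_coeff (\<lambda>z. exp (poly P z) * u z) n" for n
    unfolding fourier_coeff_circ
  proof (intro tendsto_divide tendsto_const
      integral_dominated_convergence[where w="\<lambda>t. exp C * norm (u (cis t))"])
    show "integrable circ (\<lambda>t. exp C * norm (u (cis t)))" using u by (simp add: L1_T_circ)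
    show "AE t in circ. (\<lambda>j. poly (q j) (cis t) * u (cis t) * cis (- (of_int n * t)))
        \<longlonglongrightarrow> exp (poly P (cis t)) * u (cis t) * cis (- (of_int n * t))"
      by (intro AE_I2 tendsto_intros ql)
    have "norm (poly (q j) (cis t)) \<le> exp C" for j t
      using qb[of j "cis t"] C(2)[of "cis t"] by (meson exp_le_cancel_iff norm_cis order_trans)
    then show "AE t in circ. norm (poly (q j) (cis t) * u (cis t) * cis (- (of_int n * t)))
        \<le> exp C * norm (u (cis t))" for j
      by (intro AE_I2) (simp add: norm_mult mult_right_mono)
  qed auto
  have "fourier_coeff (\<lambda>z. exp (poly P z) * u z) n = 0" if "n < 0" for n
    using lim[of n] that H1_poly_mult(1)[OF assms] by (simp add: H1_def LIMSEQ_const_iff)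
  then show "H1 (\<lambda>z. exp (poly P z) * u z)" using L by (simp add: H1_def)
  have "(\<lambda>j. fourier_coeff (\<lambda>z. poly (q j) z * u z) 0) \<longlonglongrightarrow> exp (poly P 0) * fourier_coeff u 0"
    unfolding H1_poly_mult(2)[OF assms] by (intro tendsto_intros ql)
  then show "fourier_coeff (\<lambda>z. exp (poly P z) * u z) 0 = exp (poly P 0) * fourier_coeff u 0"
    using lim LIMSEQ_unique by blast
qed

section \<open>Outer functions\<close>

lemma L2_exp_poly_mult:
  assumes "L2_T k"
  shows "L2_T (\<lambda>z. exp (poly P z) * k z)"
proof (rule poly_bounded_circle[of P])
  fix C assume C: "\<And>z. norm z = 1 \<Longrightarrow> norm (poly P z) \<le> C"
  have "norm (exp (poly P z)) \<le> exp C" if "norm z = 1" for z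
    using C[OF that] norm_exp[of "poly P z"] by (meson exp_le_cancel_iff order_trans)
  then show ?thesis
    by (intro L2_bounded_mult[where C="exp C"] assms ae_T_I meas_T_continuous continuous_intros)
qed

lemma nrm2_one: "nrm2 (\<lambda>z. 1) = 2 * pi"
  using measure_circ by (simp add: nrm2_def)

lemma fourier_coeff_0: "fourier_coeff f 0 = (\<integral>t. f (cis t) \<partial>circ) / complex_of_real (2*pi)"
  by (simp add: fourier_coeff_circ)

text \<open>Multiplication by exp w need not preserve analyticity, but exp P does. Polynomials with
  real parts tending to w boundedly a.e. reproduce the weighted norm in the limit, and Re P(0),
  being the mean of Re P, tends to the mean of w.\<close>

lemma exp_weight_approx:
  fixes w :: "real \<Rightarrow> real"
  assumes k: "L2_T k" and w: "w \<in> borel_measurable circ" and C: "\<And>t. \<bar>w t\<bar> \<le> C"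
  obtains P where
    "(\<lambda>n. nrm2 (\<lambda>z. exp (poly (P n) z) * k z)) \<longlonglongrightarrow> (\<integral>t. (exp (w t) * norm (k (cis t)))\<^sup>2 \<partial>circ)"
    "(\<lambda>n. Re (poly (P n) 0)) \<longlonglongrightarrow> (\<integral>t. w t \<partial>circ) / (2*pi)"
proof -
  obtain P where
    P: "\<And>n z. norm z = 1 \<Longrightarrow> \<bar>Re (poly (P n) z)\<bar> \<le> C + 1"
      "AE t in circ. (\<lambda>n. Re (poly (P n) (cis t))) \<longlonglongrightarrow> w t"
    by (rule bounded_measurable_limit_Re_poly[OF w C]) blast
  note [measurable] = w
  have [measurable]: "(\<lambda>t. poly p (cis t)) \<in> borel_measurable circ" for p
    using meas_T_poly by (simp add: meas_T_circ)
  have [measurable]: "(\<lambda>t. k (cis t)) \<in> borel_measurable circ"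
    using meas_T_L2[OF k] by (simp add: meas_T_circ)
  have "(\<lambda>n. \<integral>t. (exp (Re (poly (P n) (cis t))) * norm (k (cis t)))\<^sup>2 \<partial>circ)
      \<longlonglongrightarrow> (\<integral>t. (exp (w t) * norm (k (cis t)))\<^sup>2 \<partial>circ)"
  proof (rule integral_dominated_convergence[where w="\<lambda>t. (exp (C + 1))\<^sup>2 * (norm (k (cis t)))\<^sup>2"])
    show "AE t in circ. (\<lambda>n. (exp (Re (poly (P n) (cis t))) * norm (k (cis t)))\<^sup>2)
        \<longlonglongrightarrow> (exp (w t) * norm (k (cis t)))\<^sup>2"
      using P(2) by eventually_elim (intro tendsto_intros)
    show "AE t in circ. norm ((exp (Re (poly (P n) (cis t))) * norm (k (cis t)))\<^sup>2)
        \<le> (exp (C + 1))\<^sup>2 * (norm (k (cis t)))\<^sup>2" for n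
    proof (rule AE_I2)
      fix t
      have "exp (Re (poly (P n) (cis t))) \<le> exp (C + 1)"
        using P(1)[of "cis t" n] by simp
      then show "norm ((exp (Re (poly (P n) (cis t))) * norm (k (cis t)))\<^sup>2)
        \<le> (exp (C + 1))\<^sup>2 * (norm (k (cis t)))\<^sup>2"
        by (simp add: power_mult_distrib mult_right_mono power_mono del: exp_le_cancel_iff)
    qed
  qed (use k in \<open>auto simp: L2_T_circ\<close>)
  then have 1: "(\<lambda>n. nrm2 (\<lambda>z. exp (poly (P n) z) * k z)) \<longlonglongrightarrow> (\<integral>t. (exp (w t) * norm (k (cis t)))\<^sup>2 \<partial>circ)"
    by (simp add: nrm2_def norm_mult)
  have "Re (poly (P n) 0) = (\<integral>t. Re (poly (P n) (cis t)) \<partial>circ) / (2*pi)" for n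
  proof -
    have "poly (P n) 0 = (\<integral>t. poly (P n) (cis t) \<partial>circ) / complex_of_real (2*pi)"
      using fourier_coeff_poly[of "P n" 0] fourier_coeff_0[of "poly (P n)"] by (simp add: poly_0_coeff_0)
    then have "Re (poly (P n) 0) = Re (\<integral>t. poly (P n) (cis t) \<partial>circ) / (2*pi)"
      by (simp only: Re_divide_of_real)
    then show ?thesis using L1_poly[of "P n"] by (simp add: L1_T_circ)
  qed
  moreover have "(\<lambda>n. \<integral>t. Re (poly (P n) (cis t)) \<partial>circ) \<longlonglongrightarrow> (\<integral>t. w t \<partial>circ)"
    by (rule integral_dominated_convergence[where w="\<lambda>t. C + 1"]) (use P in auto)
  ultimately have 2: "(\<lambda>n. Re (poly (P n) 0)) \<longlonglongrightarrow> (\<integral>t. w t \<partial>circ) / (2*pi)"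
    by (simp add: tendsto_divide)
  show ?thesis using that 1 2 by blast
qed

text \<open>Jensen's inequality in weighted form: optimising over the weight \<open>w\<close> gives
  \<open>ln \<bar>k(0)\<bar> \<le> mean of ln \<bar>k\<bar>\<close>.\<close>

lemma weighted_Jensen:
  fixes w :: "real \<Rightarrow> real"
  assumes k: "H2 k" and w: "w \<in> borel_measurable circ" and C: "\<And>t. \<bar>w t\<bar> \<le> C"
  shows "2 * pi * (exp ((\<integral>t. w t \<partial>circ) / (2*pi)) * norm (fourier_coeff k 0))\<^sup>2
    \<le> (\<integral>t. (exp (w t) * norm (k (cis t)))\<^sup>2 \<partial>circ)"
proof (rule exp_weight_approx[OF H2_L2[OF k] w C])
  fix P
  assume lim: "(\<lambda>n. nrm2 (\<lambda>z. exp (poly (P n) z) * k z)) \<longlonglongrightarrow> (\<integral>t. (exp (w t) * norm (k (cis t)))\<^sup>2 \<partial>circ)"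
    and lim2: "(\<lambda>n. Re (poly (P n) 0)) \<longlonglongrightarrow> (\<integral>t. w t \<partial>circ) / (2*pi)"
  \<comment> \<open>Cauchy-Schwarz against the constant 1 bounds the mean of exp P k, which is exp
    (P 0) times the mean of k.\<close>
  have "2 * pi * (exp (Re (poly (P n) 0)) * norm (fourier_coeff k 0))\<^sup>2 \<le> nrm2 (\<lambda>z. exp (poly (P n) z) * k z)" for n
  proof -
    let ?a = "nrm2 (\<lambda>z. exp (poly (P n) z) * k z)"
    have "exp (Re (poly (P n) 0)) * norm (fourier_coeff k 0) = norm (fourier_coeff (\<lambda>z. (exp (poly (P n) z) * k z) * 1) 0)"
      using H1_exp_poly_mult(2)[OF H2_H1[OF k], of "P n"] by (simp add: norm_mult)
    also have "\<dots> \<le> sqrt ?a * sqrt (2 * pi) / (2 * pi)"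
      using fourier_coeff_mult_le[OF L2_exp_poly_mult[OF H2_L2[OF k]] L2_const[of 1], of "P n" 0]
      unfolding nrm2_one .
    finally have "(exp (Re (poly (P n) 0)) * norm (fourier_coeff k 0))\<^sup>2 \<le> (sqrt ?a * sqrt (2 * pi) / (2 * pi))\<^sup>2"
      by (intro power_mono) auto
    also have "\<dots> = ?a / (2*pi)"
      using nrm2_nonneg[of "\<lambda>z. exp (poly (P n) z) * k z"]
      by (simp add: power_mult_distrib power_divide) (simp add: power2_eq_square)
    finally show ?thesis by (simp add: field_simps)
  qed
  moreover have "(\<lambda>n. 2 * pi * (exp (Re (poly (P n) 0)) * norm (fourier_coeff k 0))\<^sup>2)
      \<longlonglongrightarrow> 2 * pi * (exp ((\<integral>t. w t \<partial>circ) / (2*pi)) * norm (fourier_coeff k 0))\<^sup>2"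
    by (intro tendsto_intros lim2)
  ultimately show ?thesis by (intro LIMSEQ_le[OF _ lim]) blast+
qed

text \<open>If k vanished on a set Z of positive measure, the weight m on Z would leave the weighted
  norm of k unchanged while its mean grows linearly in m, contradicting
  \<open>weighted_Jensen\<close> for large m.\<close>

lemma H2_nonzero_ae:
  assumes k: "H2 k" and k0: "fourier_coeff k 0 \<noteq> 0"
  shows "ae_T (\<lambda>z. k z \<noteq> 0)"
proof -
  have [measurable]: "(\<lambda>t. k (cis t)) \<in> borel_measurable circ"
    using meas_T_L2[OF H2_L2[OF k]] by (simp add: meas_T_circ)
  define Z where "Z = {t \<in> space circ. k (cis t) = 0}"
  have Zm [measurable]: "Z \<in> sets circ" unfolding Z_def by measurable
  let ?b = "2 * pi * (norm (fourier_coeff k 0))\<^sup>2"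
  have "measure circ Z = 0"
  proof (rule ccontr)
    assume "measure circ Z \<noteq> 0"
    then have mu: "measure circ Z > 0" by (simp add: zero_less_measure_iff)
    have b: "?b > 0" using k0 by simp
    have le: "?b * (real m * measure circ Z / pi) \<le> nrm2 k" for m :: nat
    proof -
      define w where "w = (\<lambda>t. real m * indicator Z t)"
      have "(\<integral>t. (exp (w t) * norm (k (cis t)))\<^sup>2 \<partial>circ) = nrm2 k"
        unfolding nrm2_def by (intro Bochner_Integration.integral_cong refl) (auto simp: w_def Z_def indicator_def)
      moreover have "(\<integral>t. w t \<partial>circ) = real m * measure circ Z"
        unfolding w_def using sets.sets_into_space[OF Zm] by (simp add: Int_absorb2)
      moreover have "2 * pi * (exp ((\<integral>t. w t \<partial>circ) / (2*pi)) * norm (fourier_coeff k 0))\<^sup>2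
          \<le> (\<integral>t. (exp (w t) * norm (k (cis t)))\<^sup>2 \<partial>circ)"
      proof (rule weighted_Jensen[OF k, where C="real m"])
        show "w \<in> borel_measurable circ" unfolding w_def by measurable
        show "\<bar>w t\<bar> \<le> real m" for t by (simp add: w_def indicator_def)
      qed
      ultimately have "2 * pi * (exp (real m * measure circ Z / (2*pi)) * norm (fourier_coeff k 0))\<^sup>2 \<le> nrm2 k"
        by (simp only:)
      also have "2 * pi * (exp (real m * measure circ Z / (2*pi)) * norm (fourier_coeff k 0))\<^sup>2
          = ?b * (exp (real m * measure circ Z / (2*pi)))\<^sup>2"
        by (simp add: power_mult_distrib)
      finally have bn: "?b * (exp (real m * measure circ Z / (2*pi)))\<^sup>2 \<le> nrm2 k" .
      have ex: "(exp (real m * measure circ Z / (2*pi)))\<^sup>2 = exp (real m * measure circ Z / pi)"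
        using exp_double[of "real m * measure circ Z / (2*pi)"] by simp
      have "real m * measure circ Z / pi \<le> exp (real m * measure circ Z / pi)"
        using exp_ge_add_one_self[of "real m * measure circ Z / pi"] by linarith
      then have "?b * (real m * measure circ Z / pi) \<le> ?b * exp (real m * measure circ Z / pi)"
        by (rule mult_left_mono[OF _ less_imp_le[OF b]])
      also have "\<dots> \<le> nrm2 k" using bn unfolding ex .
      finally show ?thesis .
    qed
    have c: "?b * (measure circ Z / pi) > 0" using mu k0 by simp
    obtain m :: nat where "nrm2 k / (?b * (measure circ Z / pi)) < real m"
      using reals_Archimedean2 by blast
    then have "nrm2 k < real m * (?b * (measure circ Z / pi))"
      using c by (simp only: pos_divide_less_eq)
    also have "\<dots> = ?b * (real m * measure circ Z / pi)" by simp
    finally show False using le[of m] by simp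
  qed
  then have "Z \<in> null_sets circ"
    using Zm by (simp add: null_sets_def circ.emeasure_eq_measure)
  then have "AE t in circ. t \<notin> Z" by (rule AE_not_in)
  moreover have "AE t in circ. t \<in> space circ" by (rule AE_space)
  ultimately show ?thesis unfolding ae_T_circ by eventually_elim (auto simp: Z_def)
qed

text \<open>At z = 0 the kernel in the definition of outer functions equals 1. The result says that
  Jensen's inequality is an equality, which is how outerness is exploited below.\<close>

lemma outer_fn_fourier_coeff_0:
  assumes "outer_fn k"
  shows "integrable circ (\<lambda>t. ln (norm (k (cis t))))"
    and "norm (fourier_coeff k 0) = exp ((\<integral>t. ln (norm (k (cis t))) \<partial>circ) / (2*pi))"
proof -
  show "integrable circ (\<lambda>t. ln (norm (k (cis t))))"
    using assms unfolding outer_fn_def circ_def set_integrable_def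
    by (subst integrable_restrict_space) auto
  obtain c where c: "norm c = 1" and
    e: "hardy_ext k 0 = c * exp ((LINT t:{0..2*pi}|lborel.
            (cis t + 0) / (cis t - 0) * complex_of_real (ln (norm (k (cis t)))))
            / complex_of_real (2*pi))"
    using assms unfolding outer_fn_def by force
  have "hardy_ext k 0 = fourier_coeff k 0"
    unfolding hardy_ext_def by (subst powser_zero) simp
  moreover have "(LINT t:{0..2*pi}|lborel. (cis t + 0) / (cis t - 0) * complex_of_real (ln (norm (k (cis t)))))
     = of_real (\<integral>t. ln (norm (k (cis t))) \<partial>circ)"
    unfolding circ_def set_lebesgue_integral_def
    by (subst integral_restrict_space) (auto simp: scaleR_conv_of_real simp flip: of_real_mult)
  ultimately have "fourier_coeff k 0 = c * exp (of_real ((\<integral>t. ln (norm (k (cis t))) \<partial>circ) / (2*pi)))"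
    using e by simp
  then show "norm (fourier_coeff k 0) = exp ((\<integral>t. ln (norm (k (cis t))) \<partial>circ) / (2*pi))"
    using c by (simp only: norm_mult norm_exp_eq_Re Re_complex_of_real mult_1_left)
qed

lemma outer_fn_coeff_nonzero: "outer_fn k \<Longrightarrow> fourier_coeff k 0 \<noteq> 0"
  using outer_fn_fourier_coeff_0(2)[of k] by (metis exp_not_eq_zero norm_zero)

lemma outer_fn_nonzero_ae: "H2 k \<Longrightarrow> outer_fn k \<Longrightarrow> ae_T (\<lambda>z. k z \<noteq> 0)"
  by (intro H2_nonzero_ae outer_fn_coeff_nonzero)

text \<open>The optimal weight is - ln |k|: it makes the weighted modulus 1, hence the squared norm
  2 pi, and it compensates |k(0)| exactly because k is outer. Bounded truncations of it, and then
  polynomials, come arbitrarily close.\<close>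

lemma outer_weight_approx:
  assumes k: "H2 k" and o: "outer_fn k" and e: "e > 0"
  obtains P where "nrm2 (\<lambda>z. exp (poly P z) * k z) < 2 * pi + e"
    "exp (Re (poly P 0)) * norm (fourier_coeff k 0) > 1 - e"
proof -
  define L where "L = (\<integral>t. ln (norm (k (cis t))) \<partial>circ)"
  have Li: "integrable circ (\<lambda>t. ln (norm (k (cis t))))"
    and k0: "norm (fourier_coeff k 0) = exp (L / (2*pi))"
    using outer_fn_fourier_coeff_0[OF o] by (auto simp: L_def)
  have nz: "AE t in circ. k (cis t) \<noteq> 0" using outer_fn_nonzero_ae[OF k o] by (simp add: ae_T_circ)
  have [measurable]: "(\<lambda>t. k (cis t)) \<in> borel_measurable circ"
    using meas_T_L2[OF H2_L2[OF k]] by (simp add: meas_T_circ)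
  define w where "w = (\<lambda>(n::nat) t. max (- real n) (min (real n) (- ln (norm (k (cis t))))))"
  have wm [measurable]: "w n \<in> borel_measurable circ" for n unfolding w_def by measurable
  have wb: "\<bar>w n t\<bar> \<le> real n" "\<bar>w n t\<bar> \<le> \<bar>ln (norm (k (cis t)))\<bar>" for n t
    by (auto simp: w_def)
  have wl: "(\<lambda>n. w n t) \<longlonglongrightarrow> - ln (norm (k (cis t)))" for t
  proof -
    obtain n0 :: nat where n0: "\<bar>ln (norm (k (cis t)))\<bar> < real n0" using reals_Archimedean2 by blast
    have "- ln (norm (k (cis t))) = w n t" if "n \<ge> n0" for n
      using n0 that unfolding w_def by linarith
    then show ?thesis
      by (intro Lim_transform_eventually[OF tendsto_const]) (auto simp: eventually_sequentially)
  qed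
  \<comment> \<open>The truncation satisfies w + ln |k| \<le> max 0 (ln |k|), so the weighted
    modulus never exceeds max 1 |k|; this dominates the integrands.\<close>
  have wk: "(exp (w n t) * norm (k (cis t)))\<^sup>2 \<le> (norm (k (cis t)))\<^sup>2 + 1" if "k (cis t) \<noteq> 0" for n t
  proof -
    let ?x = "norm (k (cis t))"
    have x: "?x > 0" using that by simp
    have "exp (w n t) * ?x = exp (w n t + ln ?x)" using x by (simp add: exp_add)
    moreover have "w n t + ln ?x \<le> max 0 (ln ?x)" by (auto simp: w_def)
    ultimately have "exp (w n t) * ?x \<le> max 1 ?x"
      using x by (smt (verit) exp_le_cancel_iff exp_ln exp_zero)
    then have "(exp (w n t) * ?x)\<^sup>2 \<le> (max 1 ?x)\<^sup>2" using x by (intro power_mono) auto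
    also have "\<dots> \<le> ?x\<^sup>2 + 1" by (auto simp: max_def)
    finally show ?thesis .
  qed
  have A: "(\<lambda>n. \<integral>t. (exp (w n t) * norm (k (cis t)))\<^sup>2 \<partial>circ) \<longlonglongrightarrow> (\<integral>t. 1 \<partial>circ)"
  proof (rule integral_dominated_convergence[where w="\<lambda>t. (norm (k (cis t)))\<^sup>2 + 1"])
    show "AE t in circ. (\<lambda>n. (exp (w n t) * norm (k (cis t)))\<^sup>2) \<longlonglongrightarrow> 1"
      using nz
    proof eventually_elim
      case (elim t)
      have "(\<lambda>n. (exp (w n t) * norm (k (cis t)))\<^sup>2) \<longlonglongrightarrow> (exp (- ln (norm (k (cis t)))) * norm (k (cis t)))\<^sup>2"
        by (intro tendsto_intros wl)
      then show ?case using elim by (simp add: exp_minus)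
    qed
    show "AE t in circ. norm ((exp (w n t) * norm (k (cis t)))\<^sup>2) \<le> (norm (k (cis t)))\<^sup>2 + 1" for n
      using nz by eventually_elim (use wk in simp)
    show "integrable circ (\<lambda>t. (norm (k (cis t)))\<^sup>2 + 1)" using H2_L2[OF k] by (simp add: L2_T_circ)
  qed auto
  have A': "(\<integral>t. 1 \<partial>circ) < 2 * pi + e" using e measure_circ by simp
  have "(\<lambda>n. \<integral>t. w n t \<partial>circ) \<longlonglongrightarrow> (\<integral>t. - ln (norm (k (cis t))) \<partial>circ)"
    by (rule integral_dominated_convergence[where w="\<lambda>t. \<bar>ln (norm (k (cis t)))\<bar>"])
      (use Li wl wb in auto)
  then have B: "(\<lambda>n. exp ((\<integral>t. w n t \<partial>circ) / (2*pi)) * norm (fourier_coeff k 0))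
      \<longlonglongrightarrow> exp (- L / (2*pi)) * norm (fourier_coeff k 0)"
    by (intro tendsto_intros) (auto simp: L_def)
  have B': "1 - e < exp (- L / (2*pi)) * norm (fourier_coeff k 0)"
    using e by (simp add: k0 flip: exp_add)
  have "\<forall>\<^sub>F n in sequentially. (\<integral>t. (exp (w n t) * norm (k (cis t)))\<^sup>2 \<partial>circ) < 2 * pi + e \<and>
      1 - e < exp ((\<integral>t. w n t \<partial>circ) / (2*pi)) * norm (fourier_coeff k 0)"
    by (intro eventually_conj order_tendstoD(2)[OF A A'] order_tendstoD(1)[OF B B'])
  then obtain n where n: "(\<integral>t. (exp (w n t) * norm (k (cis t)))\<^sup>2 \<partial>circ) < 2 * pi + e"
      "1 - e < exp ((\<integral>t. w n t \<partial>circ) / (2*pi)) * norm (fourier_coeff k 0)"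
    by (auto simp: eventually_sequentially)
  show ?thesis
  proof (rule exp_weight_approx[OF H2_L2[OF k] wm wb(1)])
    fix P
    assume lim: "(\<lambda>m. nrm2 (\<lambda>z. exp (poly (P m) z) * k z)) \<longlonglongrightarrow> (\<integral>t. (exp (w n t) * norm (k (cis t)))\<^sup>2 \<partial>circ)"
      and "(\<lambda>m. Re (poly (P m) 0)) \<longlonglongrightarrow> (\<integral>t. w n t \<partial>circ) / (2*pi)"
    then have lim2: "(\<lambda>m. exp (Re (poly (P m) 0)) * norm (fourier_coeff k 0)) \<longlonglongrightarrow> exp ((\<integral>t. w n t \<partial>circ) / (2*pi)) * norm (fourier_coeff k 0)"
      by (intro tendsto_intros)
    have "\<forall>\<^sub>F m in sequentially. nrm2 (\<lambda>z. exp (poly (P m) z) * k z) < 2 * pi + e \<and>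
        1 - e < exp (Re (poly (P m) 0)) * norm (fourier_coeff k 0)"
      by (intro eventually_conj order_tendstoD(2)[OF lim n(1)] order_tendstoD(1)[OF lim2 n(2)])
    then show ?thesis using that by (auto simp: eventually_sequentially)
  qed
qed

text \<open>Reduces closeness to 1 in L^2 to two numbers: a squared norm near 2 pi and a mean whose
  real part is near 1.\<close>

lemma nrm2_diff_one:
  assumes "L2_T u"
  shows "nrm2 (\<lambda>z. u z - 1) = nrm2 u + 2 * pi - 4 * pi * Re (fourier_coeff u 0)"
proof -
  have u: "integrable circ (\<lambda>t. u (cis t))" using L2_L1[OF assms] by (simp add: L1_T_circ)
  have "nrm2 (\<lambda>z. u z - 1) = (\<integral>t. (norm (u (cis t)))\<^sup>2 + 1 - 2 * Re (u (cis t)) \<partial>circ)"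
    unfolding nrm2_def
    by (intro Bochner_Integration.integral_cong) (auto simp: cmod_power2 power2_diff)
  also have "\<dots> = nrm2 u + 2 * pi - 2 * Re (\<integral>t. u (cis t) \<partial>circ)"
    using assms u measure_circ by (simp add: L2_T_circ nrm2_def)
  also have "Re (\<integral>t. u (cis t) \<partial>circ) = 2 * pi * Re (fourier_coeff u 0)"
    unfolding fourier_coeff_0 Re_divide_of_real by simp
  finally show ?thesis by simp
qed

lemma outer_approx_one:
  assumes k: "H2 k" and o: "outer_fn k" and e: "e > 0"
  obtains P where "nrm2 (\<lambda>z. exp (poly P z) * k z - 1) < e"
proof -
  \<comment> \<open>The error will be below (2 pi + d) + 2 pi - 4 pi (1 - d) = d (1 + 4 pi) =
    e.\<close>
  define d where "d = e / (1 + 4 * pi)"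
  have "1 + 4 * pi > 0" using pi_gt_zero by linarith
  then have d: "d > 0" "d * (1 + 4 * pi) = e" using e by (simp_all add: d_def)
  obtain P where P: "nrm2 (\<lambda>z. exp (poly P z) * k z) < 2 * pi + d"
    "exp (Re (poly P 0)) * norm (fourier_coeff k 0) > 1 - d"
    by (rule outer_weight_approx[OF k o d(1)])
  define v where "v = exp (poly P 0) * fourier_coeff k 0"
  \<comment> \<open>An imaginary constant added to P rotates exp P k without changing its modulus;
    this one turns its mean v into |v|.\<close>
  define Q where "Q = P + [:\<i> * of_real (- Arg v):]"
  have Q: "exp (poly Q z) = cis (- Arg v) * exp (poly P z)" for z
  proof -
    have "poly Q z = \<i> * of_real (- Arg v) + poly P z" by (simp add: Q_def)
    then show ?thesis by (simp only: exp_add cis_conv_exp)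
  qed
  have n1: "nrm2 (\<lambda>z. exp (poly Q z) * k z) = nrm2 (\<lambda>z. exp (poly P z) * k z)"
    by (simp add: nrm2_def Q norm_mult)
  have "fourier_coeff (\<lambda>z. exp (poly Q z) * k z) 0 = cis (- Arg v) * v"
    using H1_exp_poly_mult(2)[OF H2_H1[OF k], of Q] by (simp add: Q v_def mult.assoc)
  also have "cis (- Arg v) * v = cis (- Arg v) * (of_real (norm v) * cis (Arg v))"
    using rcis_cmod_Arg[of v] by (simp add: rcis_def)
  also have "\<dots> = of_real (norm v)" by (simp add: cis_mult mult.left_commute)
  finally have "Re (fourier_coeff (\<lambda>z. exp (poly Q z) * k z) 0) > 1 - d"
    using P(2) by (simp add: v_def norm_mult)
  then have "4 * pi * (1 - d) < 4 * pi * Re (fourier_coeff (\<lambda>z. exp (poly Q z) * k z) 0)"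
    by simp
  then have "nrm2 (\<lambda>z. exp (poly Q z) * k z - 1) < d * (1 + 4 * pi)"
    using P(1) unfolding nrm2_diff_one[OF L2_exp_poly_mult[OF H2_L2[OF k]]] n1
    by (simp add: algebra_simps)
  then show ?thesis using that d by simp
qed

text \<open>Since exp (P j) k tends to 1 in L^2, the coefficients of Q are limits of those of exp (P
  j) k Q, whose negative ones vanish because k Q is in H^1.\<close>

lemma Smirnov_outer_quotient:
  assumes k: "H2 k" and o: "outer_fn k" and Q: "L2_T Q" and h: "H1 (\<lambda>z. k z * Q z)"
  shows "H2 Q"
proof -
  have "\<exists>P. nrm2 (\<lambda>z. exp (poly P z) * k z - 1) < 1 / (real j + 1)" for j
    using outer_approx_one[OF k o, of "1 / (real j + 1)"] by auto
  then obtain P where P: "\<And>j. nrm2 (\<lambda>z. exp (poly (P j) z) * k z - 1) < 1 / (real j + 1)" by metis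
  have l: "(\<lambda>j. nrm2 (\<lambda>z. exp (poly (P j) z) * k z - 1)) \<longlonglongrightarrow> 0"
  proof (rule Lim_null_comparison)
    show "\<forall>\<^sub>F j in sequentially. norm (nrm2 (\<lambda>z. exp (poly (P j) z) * k z - 1)) \<le> 1 / (real j + 1)"
      using P nrm2_nonneg by (intro always_eventually) (auto simp: less_imp_le)
    show "(\<lambda>n. 1 / (real n + 1)) \<longlonglongrightarrow> 0"
      using LIMSEQ_inverse_real_of_nat by (simp add: inverse_eq_divide add.commute)
  qed
  have lim: "(\<lambda>j. fourier_coeff (\<lambda>z. (exp (poly (P j) z) * k z) * Q z) n) \<longlonglongrightarrow> fourier_coeff (\<lambda>z. 1 * Q z) n" for n
    by (rule fourier_coeff_mult_tendsto[OF L2_exp_poly_mult[OF H2_L2[OF k]] L2_const Q l])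
  have "fourier_coeff Q n = 0" if "n < 0" for n
    using lim[of n] that H1_exp_poly_mult(1)[OF h] by (simp add: H1_def mult.assoc LIMSEQ_const_iff)
  then show ?thesis using Q by (simp add: H2_def)
qed

text \<open>The case of exponent zero, phrased with \<open>gm z * f z / gp z\<close> in place of g f
  so that it can also be applied to quotients of kernel elements by inner functions.\<close>

lemma toeplitz_kernel_trivial:
  assumes gm: "H2 (\<lambda>z. cnj (gm z))" "outer_fn (\<lambda>z. cnj (gm z))"
    and gp: "H2 gp" "outer_fn gp" "rigid (\<lambda>z. (gp z)\<^sup>2)"
    and f: "H2 f" and L2: "L2_T (\<lambda>z. gm z * f z / gp z)"
    and ker: "\<And>n. n \<ge> 0 \<Longrightarrow> fourier_coeff (\<lambda>z. gm z * f z / gp z) n = 0"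
  shows "ae_T (\<lambda>z. f z = 0)"
proof -
  define k where "k = (\<lambda>z. cnj (gm z))"
  define Q where "Q = (\<lambda>z. gp z * cnj (f z / gp z))"
  define \<psi> where "\<psi> = (\<lambda>z. cnj (gm z * f z / gp z))"
  have nz: "ae_T (\<lambda>z. gp z \<noteq> 0)" using outer_fn_nonzero_ae gp by blast
  have Qn: "ae_T (\<lambda>z. norm (Q z) = norm (f z))"
    by (rule ae_T_mp[OF nz ae_T_I]) (auto simp: Q_def norm_mult norm_divide)
  have "meas_T Q" unfolding Q_def using gp f
    by (intro meas_T_mult meas_T_cnj meas_T_divide meas_T_L2 H2_L2)
  then have QL: "L2_T Q" by (rule L2_cong[OF H2_L2[OF f] _ Qn])
  have \<psi>: "H2 \<psi>" "fourier_coeff \<psi> 0 = 0"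
    unfolding \<psi>_def H2_def fourier_coeff_cnj using L2_cnj[OF L2] ker by auto
  \<comment> \<open>The same function seen twice: the kernel condition puts \<psi> in H^2 with mean
    0, so the product is in H^1, and dividing by the outer k leaves Q analytic.\<close>
  have kQ: "(\<lambda>z. k z * Q z) = (\<lambda>z. gp z * \<psi> z)"
    by (auto simp: k_def Q_def \<psi>_def)
  have Q2: "H2 Q"
  proof (rule Smirnov_outer_quotient[OF _ _ QL])
    show "H2 k" "outer_fn k" using gm by (simp_all add: k_def)
    show "H1 (\<lambda>z. k z * Q z)" unfolding kQ by (rule H2_mult(1)[OF gp(1) \<psi>(1)])
  qed
  have k2: "H2 k" using gm by (simp add: k_def)
  \<comment> \<open>Evaluate both forms of k Q at the origin, where \<psi> vanishes and k does
    not.\<close>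
  have "fourier_coeff k 0 * fourier_coeff Q 0 = 0"
    using H2_mult(2)[OF k2 Q2] H2_mult(2)[OF gp(1) \<psi>(1)] \<psi>(2) by (simp add: kQ)
  moreover have "fourier_coeff k 0 \<noteq> 0" using gm outer_fn_coeff_nonzero by (simp add: k_def)
  ultimately have Q0: "fourier_coeff Q 0 = 0" by simp
  \<comment> \<open>The competitor for rigidity: since \<open>f z * Q z\<close> is
    \<open>gp z ^ 2\<close> times |f / gp|^2, the quotient of h by \<open>gp z ^ 2\<close> is 1 + |f
    / gp|^2.\<close>
  define h where "h = (\<lambda>z. gp z * gp z + f z * Q z)"
  have h1: "H1 h" unfolding h_def by (intro H1_add H2_mult gp f Q2)
  have "ae_T (\<lambda>z. Im (h z / (gp z)\<^sup>2) = 0 \<and> Re (h z / (gp z)\<^sup>2) > 0)"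
  proof (rule ae_T_mp[OF nz ae_T_I], rule impI)
    fix z assume z: "gp z \<noteq> 0"
    have "f z / gp z * cnj (f z / gp z) = of_real ((norm (f z / gp z))\<^sup>2)"
      by (simp only: complex_norm_square)
    moreover have "h z / (gp z)\<^sup>2 = 1 + f z / gp z * cnj (f z / gp z)"
    proof -
      have "f z * Q z = (gp z)\<^sup>2 * (f z / gp z * cnj (f z / gp z))"
        using z by (simp add: Q_def power2_eq_square)
      then have "h z = (gp z)\<^sup>2 * (1 + f z / gp z * cnj (f z / gp z))"
        unfolding h_def by (simp add: power2_eq_square distrib_left)
      then show ?thesis using z by simp
    qed
    ultimately have "h z / (gp z)\<^sup>2 = of_real (1 + (norm (f z / gp z))\<^sup>2)"
      by (simp only: of_real_add of_real_1)
    moreover have "1 + (norm (f z / gp z))\<^sup>2 > 0" by (intro add_pos_nonneg) auto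
    ultimately show "Im (h z / (gp z)\<^sup>2) = 0 \<and> Re (h z / (gp z)\<^sup>2) > 0"
      by (simp only: Im_complex_of_real Re_complex_of_real)
  qed
  then obtain l :: real where l: "ae_T (\<lambda>z. h z = complex_of_real l * (gp z)\<^sup>2)"
    using gp(3)[unfolded rigid_def] h1 by blast
  then have fQ: "ae_T (\<lambda>z. f z * Q z = complex_of_real (l - 1) * (gp z * gp z))"
    by (rule ae_T_mp[OF _ ae_T_I]) (auto simp: h_def power2_eq_square algebra_simps)
  have m: "meas_T (\<lambda>z. f z * Q z)" "meas_T (\<lambda>z. complex_of_real (l - 1) * (gp z * gp z))"
    by (intro meas_T_mult meas_T_const meas_T_L2[OF H2_L2] f Q2 gp)+
  \<comment> \<open>At the origin f Q vanishes because Q does, while gp does not; hence l = 1. Then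
    f Q = 0 a.e., and |Q| = |f| finishes the argument.\<close>
  have "complex_of_real (l - 1) * (fourier_coeff gp 0 * fourier_coeff gp 0) = 0"
    using fourier_coeff_cong[OF m fQ, of 0] H2_mult(2)[OF f Q2] H2_mult(2)[OF gp(1) gp(1)] Q0
    by (simp add: fourier_coeff_cmult)
  moreover have "fourier_coeff gp 0 \<noteq> 0" using gp outer_fn_coeff_nonzero by blast
  ultimately have "l = 1" by simp
  then have "ae_T (\<lambda>z. f z * Q z = 0)" using fQ by simp
  then show ?thesis using Qn unfolding ae_T_circ by eventually_elim auto
qed

section \<open>Bounded analytic functions and Blaschke products\<close>

lemma Hinf_H2: "Hinf f \<Longrightarrow> H2 f"
  by (auto simp: Hinf_def H2_def Linf_T_def intro: L2_bounded)

lemma HinfI: "meas_T f \<Longrightarrow> ae_T (\<lambda>z. norm (f z) \<le> C) \<Longrightarrow> (\<And>n. n < 0 \<Longrightarrow> fourier_coeff f n = 0) \<Longrightarrow> Hinf f"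
  by (auto simp: Hinf_def Linf_T_def)

lemma L2_Linf_mult: "Linf_T q \<Longrightarrow> L2_T f \<Longrightarrow> L2_T (\<lambda>z. q z * f z)"
  by (auto simp: Linf_T_def intro: L2_bounded_mult)

lemma Hinf_mult_H2: "Hinf q \<Longrightarrow> H2 f \<Longrightarrow> H2 (\<lambda>z. q z * f z)"
  using H2_mult(1)[OF Hinf_H2, of q f] by (auto simp: H2_def H1_def Hinf_def intro: L2_Linf_mult)

lemma Linf_mult:
  assumes "Linf_T q" "Linf_T r"
  shows "Linf_T (\<lambda>z. q z * r z)"
proof -
  obtain C D where C: "ae_T (\<lambda>z. norm (q z) \<le> C)" and D: "ae_T (\<lambda>z. norm (r z) \<le> D)"
    using assms by (auto simp: Linf_T_def)
  have "ae_T (\<lambda>z. norm (q z * r z) \<le> C * D)"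
    using C D unfolding ae_T_circ
  proof eventually_elim
    case (elim t)
    have "0 \<le> C" using elim(1) norm_ge_zero order_trans by blast
    then show ?case using elim by (simp add: norm_mult mult_mono)
  qed
  then show ?thesis using assms by (auto simp: Linf_T_def intro: meas_T_mult)
qed

lemma Hinf_mult: "Hinf q \<Longrightarrow> Hinf r \<Longrightarrow> Hinf (\<lambda>z. q z * r z)"
  using Hinf_mult_H2[OF _ Hinf_H2, of q r] by (auto simp: H2_def Hinf_def intro: Linf_mult)

lemma Hinf_poly: "Hinf (poly p)"
  by (rule poly_bounded_circle[of p], rule HinfI) (auto intro: meas_T_poly ae_T_I simp: fourier_coeff_poly)

lemma Hinf_const: "Hinf (\<lambda>z. c)"
proof -
  have "poly [:c:] = (\<lambda>z. c)" by auto
  then show ?thesis using Hinf_poly[of "[:c:]"] by simp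
qed

lemma Hinf_diff: "Hinf q \<Longrightarrow> Hinf r \<Longrightarrow> Hinf (\<lambda>z. q z - r z)"
proof -
  assume a: "Hinf q" "Hinf r"
  then obtain C D where "ae_T (\<lambda>z. norm (q z) \<le> C)" "ae_T (\<lambda>z. norm (r z) \<le> D)"
    by (auto simp: Linf_T_def Hinf_def)
  then have "ae_T (\<lambda>z. norm (q z - r z) \<le> C + D)"
    unfolding ae_T_circ by eventually_elim (metis add_mono norm_triangle_ineq4 order_trans)
  then show ?thesis
    using a H2_diff[OF Hinf_H2 Hinf_H2, of q r]
    by (intro HinfI) (auto simp: Hinf_def Linf_T_def H2_def intro: meas_T_diff)
qed

lemma Hinf_power: "Hinf q \<Longrightarrow> Hinf (\<lambda>z. q z ^ n)"
  by (induction n) (auto intro: Hinf_const Hinf_mult)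

lemma inner_fn_Hinf: "inner_fn \<theta> \<Longrightarrow> Hinf \<theta>"
  by (simp add: inner_fn_def)

section \<open>Blaschke factors and division with remainder in H^2\<close>

lemma circle_neq: "norm z = 1 \<Longrightarrow> norm a < 1 \<Longrightarrow> z \<noteq> a \<and> 1 - cnj a * z \<noteq> 0"
proof -
  assume z: "norm z = 1" and a: "norm a < 1"
  have "norm (cnj a * z) < 1" using a z by (simp add: norm_mult)
  then show ?thesis using z a by auto
qed

lemma blaschke_factor_circle:
  assumes "norm z = 1"
  shows "1 - cnj a * z = z * cnj (z - a)" "norm (1 - cnj a * z) = norm (z - a)"
proof -
  show "1 - cnj a * z = z * cnj (z - a)"
    using mult_cnj_circle[OF assms] by (simp add: algebra_simps)
  then show "norm (1 - cnj a * z) = norm (z - a)"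
    using assms by (metis complex_mod_cnj mult_1 norm_mult)
qed

lemma fourier_coeff_linear_mult:
  assumes "L1_T h"
  shows "fourier_coeff (\<lambda>z. (z - a) * h z) n = fourier_coeff h (n - 1) - a * fourier_coeff h n"
proof -
  have "(\<lambda>z. (z - a) * h z) = (\<lambda>z. z ^ 1 * h z - a * h z)" by (auto simp: algebra_simps)
  then show ?thesis
    using assms L1_power_mult[OF assms, of 1] fourier_coeff_power_mult[of 1 h n]
    by (simp add: fourier_coeff_diff L1_cmult fourier_coeff_cmult)
qed

text \<open>Coefficient n of (z - a) h is that of h at n - 1 minus a times that at n. For negative n
  it is 0, so vanishing at -1 propagates downwards.\<close>

lemma H2_neg_coeff_division:
  assumes h: "L2_T h" and H: "H1 (\<lambda>z. (z - a) * h z)" and "fourier_coeff h (-1) = 0"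
  shows "H2 h"
proof -
  have "fourier_coeff h (- 1 - int m) = 0" for m
  proof (induction m)
    case (Suc m)
    have "fourier_coeff (\<lambda>z. (z - a) * h z) (- 1 - int m) = 0"
      using H by (simp add: H1_def)
    then show ?case using Suc fourier_coeff_linear_mult[OF L2_L1[OF h], of a "- 1 - int m"]
      by (simp add: algebra_simps)
  qed (use assms in simp)
  then have "fourier_coeff h n = 0" if "n < 0" for n
  proof -
    have "n = - 1 - int (nat (- 1 - n))" using that by simp
    then show ?thesis using \<open>\<And>m. fourier_coeff h (- 1 - int m) = 0\<close> by metis
  qed
  then show ?thesis using h by (simp add: H2_def)
qed

text \<open>Serves for coefficient recursions with ratio a: iterating m times gives a^m times
  another Fourier coefficient, bounded independently of m.\<close>

lemma geometric_null:
  fixes f :: "nat \<Rightarrow> complex"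
  assumes a: "norm a < 1" and b: "\<And>m. norm (f m) \<le> C" and e: "\<And>m. x = a ^ m * f m"
  shows "x = 0"
proof -
  have "norm x \<le> norm a ^ m * C" for m
    using b[of m] e[of m] by (simp add: norm_mult norm_power mult_left_mono)
  moreover have "(\<lambda>m. norm a ^ m * C) \<longlonglongrightarrow> 0 * C"
    using a by (intro tendsto_mult LIMSEQ_power_zero tendsto_const) simp
  ultimately have "norm x \<le> 0 * C" by (intro LIMSEQ_le_const[of _ "0 * C"]) auto
  then show ?thesis by simp
qed

lemma bounded_circle_continuous:
  assumes "continuous_on (sphere 0 1) (f :: complex \<Rightarrow> complex)"
  obtains C where "\<And>z. norm z = 1 \<Longrightarrow> norm (f z) \<le> C"
proof -
  have "bounded (f ` sphere 0 1)"
    by (intro compact_imp_bounded compact_continuous_image assms compact_sphere)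
  then obtain C where "\<And>z. z \<in> sphere 0 1 \<Longrightarrow> norm (f z) \<le> C"
    unfolding bounded_iff by blast
  then show ?thesis using that[of C] by simp
qed

lemma continuous_on_pole: "norm (a::complex) < 1 \<Longrightarrow> continuous_on (sphere 0 1) (\<lambda>z. 1 / (z - a))"
  using circle_neq[of _ a] by (intro continuous_intros) auto

text \<open>On the circle 1/(z - a) is the sum of a^k z^(-k-1). The proof avoids the series:
  multiplying by z - a gives a recursion, boundedness makes coefficient 0 vanish, and the recursion
  at n = 0 then yields 1.\<close>

lemma fourier_coeff_pole:
  assumes a: "norm a < 1"
  shows "fourier_coeff (\<lambda>z. 1 / (z - a)) (-1) = 1"
proof (rule bounded_circle_continuous[OF continuous_on_pole[OF a]])
  fix C assume C: "\<And>z. norm z = 1 \<Longrightarrow> norm (1 / (z - a)) \<le> C"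
  let ?h = "\<lambda>z. 1 / (z - a)"
  have m: "meas_T ?h" by (rule meas_T_continuous[OF continuous_on_pole[OF a]])
  have L: "L1_T ?h" by (rule meas_T_bounded_L1[OF m ae_T_I[OF C]])
  have mm: "meas_T (\<lambda>z. (z - a) * ?h z)"
    using meas_T_mult[OF meas_T_poly[of "[:-a,1:]"] m] by simp
  have rec: "fourier_coeff ?h (n - 1) - a * fourier_coeff ?h n = (if n = 0 then 1 else 0)" for n
  proof -
    have "fourier_coeff (\<lambda>z. (z - a) * ?h z) n = fourier_coeff (\<lambda>z. 1) n"
      using a circle_neq[of _ a] by (intro fourier_coeff_cong mm meas_T_const ae_T_I) auto
    then show ?thesis using fourier_coeff_linear_mult[OF L, of a n] fourier_coeff_one[of n] by simp
  qed
  have "fourier_coeff ?h 0 = a ^ m * fourier_coeff ?h (int m)" for m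
  proof (induction m)
    case (Suc m)
    have "fourier_coeff ?h (int m) = a * fourier_coeff ?h (int (Suc m))"
      using rec[of "int (Suc m)"] by simp
    then show ?case using Suc by simp
  qed simp
  moreover have "norm (fourier_coeff ?h (int m)) \<le> C" for m
    by (rule fourier_coeff_norm_le[OF m ae_T_I[OF C]])
  ultimately have "fourier_coeff ?h 0 = 0"
    by (intro geometric_null[OF a, of "\<lambda>m. fourier_coeff ?h (int m)" C])
  then show ?thesis using rec[of 0] by simp
qed

lemma Hinf_cauchy_kernel:
  assumes a: "norm a < 1"
  shows "Hinf (\<lambda>z. 1 / (1 - cnj a * z))"
proof -
  let ?h = "\<lambda>z. 1 / (1 - cnj a * z)"
  have c: "continuous_on (sphere 0 1) ?h"
    using circle_neq[of _ a] a by (intro continuous_intros) auto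
  show ?thesis
  proof (rule bounded_circle_continuous[OF c])
    fix C assume C: "\<And>z. norm z = 1 \<Longrightarrow> norm (?h z) \<le> C"
    have m: "meas_T ?h" by (rule meas_T_continuous[OF c])
    have L: "L1_T ?h" by (rule meas_T_bounded_L1[OF m ae_T_I[OF C]])
    have rec: "fourier_coeff ?h n = cnj a * fourier_coeff ?h (n - 1)" if "n < 0" for n
    proof -
      let ?k = "\<lambda>z. ?h z - cnj a * (z ^ 1 * ?h z)"
      have "fourier_coeff ?k n = fourier_coeff (\<lambda>z. 1) n"
      proof (intro fourier_coeff_cong meas_T_const ae_T_I)
        show "meas_T ?k" using L1_power_mult[OF L, of 1]
          by (intro meas_T_diff m meas_T_mult[OF meas_T_const] meas_T_L1)
        show "?k z = 1" if "norm z = 1" for z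
          using circle_neq[OF that a] by (simp add: diff_divide_distrib[symmetric])
      qed
      then show ?thesis
        using that fourier_coeff_one[of n]
        unfolding fourier_coeff_diff[OF L L1_cmult[OF L1_power_mult[OF L]]] fourier_coeff_cmult
          fourier_coeff_power_mult by simp
    qed
    have "fourier_coeff ?h n = 0" if "n < 0" for n
    proof -
      have "fourier_coeff ?h n = cnj a ^ m * fourier_coeff ?h (n - int m)" for m
      proof (induction m)
        case (Suc m)
        have "fourier_coeff ?h (n - int m) = cnj a * fourier_coeff ?h (n - int (Suc m))"
          using rec[of "n - int m"] that by (simp add: algebra_simps)
        then show ?case using Suc by simp
      qed simp
      moreover have "norm (fourier_coeff ?h (n - int m)) \<le> C" for m
        by (rule fourier_coeff_norm_le[OF m ae_T_I[OF C]])
      ultimately show ?thesis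
        using a by (intro geometric_null[of "cnj a" "\<lambda>m. fourier_coeff ?h (n - int m)" C]) auto
    qed
    then show ?thesis by (intro HinfI[OF m ae_T_I[OF C]])
  qed
qed

text \<open>By Cauchy's formula coefficient -1 of f/(z - a) is the value of f at a. Subtracting this
  value c cancels the pole, so (f - c)/(z - a) is analytic; the factor 1 - cnj a z is then
  restored.\<close>

lemma H2_divide_blaschke_factor:
  assumes f: "H2 f" and a: "norm a < 1"
  obtains c h where "H2 h" "\<And>z. norm z = 1 \<Longrightarrow> f z = c + (z - a) / (1 - cnj a * z) * h z"
proof (rule bounded_circle_continuous[OF continuous_on_pole[OF a]])
  fix C assume C: "\<And>z. norm z = 1 \<Longrightarrow> norm (1 / (z - a)) \<le> C"
  have m: "meas_T (\<lambda>z. 1 / (z - a))" by (rule meas_T_continuous[OF continuous_on_pole[OF a]])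
  define F where "F = (\<lambda>z. 1 / (z - a) * f z)"
  define c where "c = fourier_coeff F (-1)"
  define h where "h = (\<lambda>z. F z - c * (1 / (z - a)))"
  have FL: "L2_T F" unfolding F_def by (rule L2_bounded_mult[OF H2_L2[OF f] m ae_T_I[OF C]])
  have pL: "L2_T (\<lambda>z. 1 / (z - a))" by (rule L2_bounded[OF m ae_T_I[OF C]])
  have hL: "L2_T h" unfolding h_def by (intro L2_diff FL L2_cmult pL)
  have hz: "(z - a) * h z = f z - c" if "norm z = 1" for z
    using circle_neq[OF that a] by (simp add: h_def F_def right_diff_distrib)
  have "fourier_coeff h (-1) = 0"
    using fourier_coeff_pole[OF a]
    by (simp add: h_def fourier_coeff_diff L2_L1 FL L2_cmult pL fourier_coeff_cmult c_def del: times_divide_eq_right)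
  moreover have "H1 (\<lambda>z. (z - a) * h z)"
  proof -
    have L: "L1_T (\<lambda>z. (z - a) * h z)" using L1_poly_mult[OF L2_L1[OF hL], of "[:-a,1:]"] by simp
    have fc: "H2 (\<lambda>z. f z - c)" by (rule H2_diff[OF f Hinf_H2[OF Hinf_const]])
    have "fourier_coeff (\<lambda>z. (z - a) * h z) n = fourier_coeff (\<lambda>z. f z - c) n" for n
      by (intro fourier_coeff_cong ae_T_I meas_T_L1[OF L] meas_T_L2[OF H2_L2[OF fc]] hz)
    then show ?thesis using L fc by (simp add: H1_def H2_def)
  qed
  ultimately have hH: "H2 h" by (intro H2_neg_coeff_division[OF hL])
  define k where "k = (\<lambda>z. poly [:1, - cnj a:] z * h z)"
  have "H2 k" unfolding k_def by (rule Hinf_mult_H2[OF Hinf_poly hH])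
  moreover have "f z = c + (z - a) / (1 - cnj a * z) * k z" if "norm z = 1" for z
  proof -
    have "(z - a) / (1 - cnj a * z) * k z = (z - a) * h z"
      using circle_neq[OF that a] by (simp add: k_def mult.commute)
    then show ?thesis using hz[OF that] by simp
  qed
  ultimately show ?thesis using that by blast
qed

text \<open>Iterated division, as in Newton interpolation: the remainder lies in the span of
  \<open>length as\<close> fixed partial products. This makes a dimension count possible.\<close>

lemma H2_divide_blaschke:
  assumes "H2 f" "\<forall>a\<in>set as. norm a < 1"
  shows "\<exists>c h. H2 h \<and> (\<forall>z. norm z = 1 \<longrightarrow>
    f z = (\<Sum>j<length as. c j * (\<Prod>a\<leftarrow>take j as. (z - a) / (1 - cnj a * z)))
      + (\<Prod>a\<leftarrow>as. (z - a) / (1 - cnj a * z)) * h z)"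
  using assms
proof (induction as arbitrary: f)
  case Nil
  then show ?case by auto
next
  case (Cons a as)
  obtain c0 k where k: "H2 k" "\<And>z. norm z = 1 \<Longrightarrow> f z = c0 + (z - a) / (1 - cnj a * z) * k z"
    by (rule H2_divide_blaschke_factor[OF Cons.prems(1), of a]) (use Cons.prems(2) in auto)
  obtain c h where h: "H2 h" "\<And>z. norm z = 1 \<Longrightarrow>
    k z = (\<Sum>j<length as. c j * (\<Prod>a\<leftarrow>take j as. (z - a) / (1 - cnj a * z)))
      + (\<Prod>a\<leftarrow>as. (z - a) / (1 - cnj a * z)) * h z"
    using Cons.IH[OF k(1)] Cons.prems(2) by auto
  show ?case
  \<comment> \<open>The new constant c0 becomes coefficient 0 and the coefficients of k move up by
    one, because each partial product gains the factor of a.\<close>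
  proof (intro exI[of _ "case_nat c0 c"] exI[of _ h] conjI allI impI h(1))
    fix z :: complex assume z: "norm z = 1"
    show "f z = (\<Sum>j<length (a # as). case_nat c0 c j * (\<Prod>a\<leftarrow>take j (a # as). (z - a) / (1 - cnj a * z)))
      + (\<Prod>a\<leftarrow>a # as. (z - a) / (1 - cnj a * z)) * h z"
      unfolding k(2)[OF z] h(2)[OF z] list.size add_0_right add_Suc_right sum.lessThan_Suc_shift
      by (simp add: distrib_left sum_distrib_left mult.left_commute mult.assoc)
  qed
qed

text \<open>Gaussian elimination: i indexes unknowns and j equations. If equation d involves an
  unknown p, solving for p leaves the system B with one unknown and one equation fewer.\<close>

lemma homogeneous_system_nontrivial_solution:
  fixes A :: "'i \<Rightarrow> nat \<Rightarrow> 'a::field"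
  assumes "finite I" "d < card I"
  shows "\<exists>c. (\<exists>i\<in>I. c i \<noteq> 0) \<and> (\<forall>j<d. (\<Sum>i\<in>I. c i * A i j) = 0)"
  using assms
proof (induction d arbitrary: A I)
  case 0
  then have "I \<noteq> {}" by auto
  then show ?case by (intro exI[of _ "\<lambda>_. 1"]) auto
next
  case (Suc d)
  show ?case
  proof (cases "\<forall>i\<in>I. A i d = 0")
    case True
    obtain c where "\<exists>i\<in>I. c i \<noteq> 0" "\<forall>j<d. (\<Sum>i\<in>I. c i * A i j) = 0"
      using Suc.IH[of I A] Suc.prems by auto
    then show ?thesis using True by (intro exI[of _ c]) (auto simp: less_Suc_eq)
  next
    case False
    then obtain p where p: "p \<in> I" "A p d \<noteq> 0" by blast
    define B where "B = (\<lambda>i j. A i j - A i d / A p d * A p j)"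
    obtain c where c: "\<exists>i\<in>I-{p}. c i \<noteq> 0" "\<And>j. j < d \<Longrightarrow> (\<Sum>i\<in>I-{p}. c i * B i j) = 0"
    proof -
      have "d < card (I - {p})" using Suc.prems p by simp
      then show ?thesis using Suc.IH[of "I - {p}" B] Suc.prems(1) that by blast
    qed
    define e where "e = c(p := - (\<Sum>i\<in>I-{p}. c i * A i d) / A p d)"
    have sum: "(\<Sum>i\<in>I. e i * A i j) = (\<Sum>i\<in>I-{p}. c i * B i j)" for j
    proof -
      have "(\<Sum>i\<in>I. e i * A i j) = e p * A p j + (\<Sum>i\<in>I-{p}. e i * A i j)"
        using Suc.prems p by (simp add: sum.remove)
      also have "(\<Sum>i\<in>I-{p}. e i * A i j) = (\<Sum>i\<in>I-{p}. c i * A i j)"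
        by (intro sum.cong) (auto simp: e_def)
      also have "e p * A p j = - (\<Sum>i\<in>I-{p}. c i * (A i d / A p d * A p j))"
        by (simp add: e_def sum_distrib_left sum_divide_distrib mult_ac)
      also have "\<dots> + (\<Sum>i\<in>I-{p}. c i * A i j) = (\<Sum>i\<in>I-{p}. c i * B i j)"
        by (simp add: B_def right_diff_distrib sum_subtractf)
      finally show ?thesis .
    qed
    have "(\<Sum>i\<in>I. e i * A i j) = 0" if "j < Suc d" for j
    proof (cases "j = d")
      case True
      then show ?thesis unfolding sum using p by (simp add: B_def)
    next
      case False
      then show ?thesis unfolding sum using c(2) that by simp
    qed
    moreover have "\<exists>i\<in>I. e i \<noteq> 0" using c(1) by (auto simp: e_def)
    ultimately show ?thesis by blast
  qed
qed

section \<open>Rational inner functions\<close>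

text \<open>A single point is null because z - a, having nonzero value at the origin if a is
  nonzero, cannot vanish on a set of positive measure.\<close>

lemma ae_T_neq: "ae_T (\<lambda>z. z \<noteq> a)"
proof (cases "a = 0")
  case True
  then show ?thesis by (intro ae_T_I) auto
next
  case False
  have "ae_T (\<lambda>z. poly [:-a, 1:] z \<noteq> 0)"
    using False by (intro H2_nonzero_ae H2_poly) (simp only: fourier_coeff_poly, simp)
  then show ?thesis by simp
qed

text \<open>On the circle |A|^2 = |R|^2 becomes, after multiplication by a power of z, an identity
  between polynomials, which then holds in the whole plane.\<close>

lemma poly_reflection_identity:
  assumes "ae_T (\<lambda>z. norm (poly A z) = norm (poly R z))"
  shows "A * reflect_poly (map_poly cnj A) * monom 1 (degree R)
       = R * reflect_poly (map_poly cnj R) * monom 1 (degree A)" (is "?L = ?R")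
proof -
  have "ae_T (\<lambda>z. poly (?L - ?R) z = 0)"
  proof -
    have "norm (poly A z) = norm (poly R z) \<longrightarrow> poly (?L - ?R) z = 0" if z: "norm z = 1" for z
    proof
      assume e: "norm (poly A z) = norm (poly R z)"
      have "poly A z * cnj (poly A z) = poly R z * cnj (poly R z)"
        using e by (simp flip: complex_norm_square)
      then show "poly (?L - ?R) z = 0"
        by (simp add: poly_reflect_cnj[OF z] poly_monom)
    qed
    then show ?thesis by (rule ae_T_mp[OF assms ae_T_I])
  qed
  then show ?thesis using poly_eq_0_if_ae by fastforce
qed

lemma poly_reflect_cnj_nz:
  "z \<noteq> 0 \<Longrightarrow> poly (reflect_poly (map_poly cnj p)) z = z ^ degree p * cnj (poly p (1 / cnj z))"
  by (simp add: poly_reflect_poly_nz degree_map_poly divide_inverse)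

lemma root_reflection:
  assumes "ae_T (\<lambda>z. norm (poly A z) = norm (poly R z))" "b \<noteq> 0" "poly A b = 0"
  shows "poly R b = 0 \<or> poly R (1 / cnj b) = 0"
  using arg_cong[OF poly_reflection_identity[OF assms(1)], of "\<lambda>p. poly p b"] assms(2,3)
  by (auto simp: poly_monom poly_reflect_cnj_nz)

lemma poly_eq_linear_mult: "poly p a = (0::complex) \<Longrightarrow> \<exists>q. p = [:-a, 1:] * q"
  by (metis dvdE poly_eq_0_iff_dvd)

lemma degree_linear_mult: "q \<noteq> 0 \<Longrightarrow> degree ([:-a, 1:] * q) = Suc (degree (q :: complex poly))"
  by (subst degree_mult_eq) auto

text \<open>A root of A in the closed disc is also a root of R and can be cancelled, lowering the
  degree. On the circle this is root reflection, as a = 1 / cnj a; inside, a nonzero R(a) would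
  leave \<theta> with a pole.\<close>

lemma rational_inner_no_roots_in_disc:
  assumes \<theta>: "H2 \<theta>" "ae_T (\<lambda>z. norm (\<theta> z) = 1)"
    and "A \<noteq> 0" "ae_T (\<lambda>z. poly A z * \<theta> z = poly R z)"
  shows "\<exists>A R. A \<noteq> 0 \<and> ae_T (\<lambda>z. poly A z * \<theta> z = poly R z) \<and> (\<forall>a. poly A a = 0 \<longrightarrow> norm a > 1)"
  using assms(3,4)
proof (induction "degree A" arbitrary: A R rule: less_induct)
  case less
  show ?case
  proof (cases "\<forall>a. poly A a = 0 \<longrightarrow> norm a > 1")
    case True
    then show ?thesis using less.prems by blast
  next
    case False
    then obtain a where a: "poly A a = 0" "norm a \<le> 1" by force
    obtain A1 where A1: "A = [:-a, 1:] * A1" using poly_eq_linear_mult[OF a(1)] by blast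
    have "poly R a = 0"
    proof (cases "norm a = 1")
      case True
      have "ae_T (\<lambda>z. norm (poly A z) = norm (poly R z))"
        using less.prems(2) \<theta>(2) unfolding ae_T_circ
        by eventually_elim (metis mult.right_neutral norm_mult)
      then have "poly R a = 0 \<or> poly R (1 / cnj a) = 0"
        using True a(1) by (intro root_reflection) auto
      moreover have "1 / cnj a = a"
        using mult_cnj_circle[OF True] by (metis divide_eq_eq mult_zero_right zero_neq_one)
      ultimately show ?thesis by simp
    next
      case False
      then have a1: "norm a < 1" using a by simp
      define c where "c = poly R a"
      have "poly (R - [:c:]) a = 0" by (simp add: c_def)
      then obtain R1 where R1: "R - [:c:] = [:-a, 1:] * R1" using poly_eq_linear_mult by blast
      have Rz: "poly R z = (z - a) * poly R1 z + c" for z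
        using arg_cong[OF R1, of "\<lambda>p. poly p z"] by (simp add: algebra_simps)
      \<comment> \<open>u equals c/(z - a) a.e. with c = R(a). It lies in H^2, so coefficient -1,
        which is c, must vanish.\<close>
      define u where "u = (\<lambda>z. poly A1 z * \<theta> z - poly R1 z)"
      have u: "H2 u" unfolding u_def by (intro H2_diff H2_poly Hinf_mult_H2 Hinf_poly \<theta>)
      have "ae_T (\<lambda>z. u z = c * (1 / (z - a)))"
      proof (rule ae_T_mp[OF less.prems(2) ae_T_I], rule impI)
        fix z assume z: "norm z = 1" and e: "poly A z * \<theta> z = poly R z"
        have "(z - a) * u z = c" using e unfolding Rz by (simp add: u_def A1 algebra_simps)
        then show "u z = c * (1 / (z - a))" using circle_neq[OF z a1] by (auto simp: field_simps)
      qed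
      then have "fourier_coeff u (-1) = fourier_coeff (\<lambda>z. c * (1 / (z - a))) (-1)"
        by (intro fourier_coeff_cong meas_T_L2[OF H2_L2[OF u]] meas_T_mult[OF meas_T_const]
            meas_T_continuous[OF continuous_on_pole[OF a1]])
      then have "c = 0"
        using u fourier_coeff_pole[OF a1] unfolding fourier_coeff_cmult by (simp add: H2_def)
      then show ?thesis by (simp add: c_def)
    qed
    then obtain R1 where R1: "R = [:-a, 1:] * R1" using poly_eq_linear_mult by blast
    have nz: "A1 \<noteq> 0" using less.prems A1 by auto
    have "ae_T (\<lambda>z. poly A1 z * \<theta> z = poly R1 z)"
      using less.prems(2) ae_T_neq[of a] unfolding ae_T_circ
    proof eventually_elim
      case (elim t)
      then have "(cis t - a) * (poly A1 (cis t) * \<theta> (cis t)) = (cis t - a) * poly R1 (cis t)"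
        by (simp add: A1 R1 algebra_simps)
      then show ?case using elim(2) by simp
    qed
    moreover have "degree A1 < degree A" unfolding A1 degree_linear_mult[OF nz] by simp
    ultimately show ?thesis using less.hyps nz by blast
  qed
qed

text \<open>Strips off roots. A root b of A lies outside the closed disc; either R has the same root
  and it cancels, or R has the root 1 / cnj b and the pair forms a Blaschke factor. Once A is
  constant, roots of R at 0 give factors z, and what remains is constant.\<close>

lemma unimodular_rational_blaschke:
  assumes "A \<noteq> 0" "\<forall>a. poly A a = 0 \<longrightarrow> norm a > 1"
    and "ae_T (\<lambda>z. norm (poly A z) = norm (poly R z))"
  shows "\<exists>c as. norm c = 1 \<and> (\<forall>a\<in>set as. norm a < 1) \<and>
    (\<forall>z. norm z = 1 \<longrightarrow> poly R z = c * (\<Prod>a\<leftarrow>as. (z - a) / (1 - cnj a * z)) * poly A z)"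
  using assms
proof (induction "degree A + degree R" arbitrary: A R rule: less_induct)
  case less
  have Rnz: "R \<noteq> 0"
  proof
    assume "R = 0"
    then have "ae_T (\<lambda>z. poly A z = 0)" using less.prems(3) by simp
    then show False using poly_eq_0_if_ae less.prems(1) by blast
  qed
  show ?case
  proof (cases "\<exists>b. poly A b = 0")
    case True
    then obtain b where b: "poly A b = 0" by blast
    then have nb: "norm b > 1" using less.prems by blast
    then have b0: "b \<noteq> 0" by auto
    obtain A1 where A1: "A = [:-b, 1:] * A1" using poly_eq_linear_mult[OF b] by blast
    have A1nz: "A1 \<noteq> 0" using less.prems A1 by auto
    have dA: "degree A = Suc (degree A1)" unfolding A1 degree_linear_mult[OF A1nz] by simp
    have rA1: "\<forall>a. poly A1 a = 0 \<longrightarrow> norm a > 1" using less.prems(2) by (auto simp: A1)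
    from root_reflection[OF less.prems(3) b0 b] show ?thesis
    proof
      assume "poly R b = 0"
      then obtain R1 where R1: "R = [:-b, 1:] * R1" using poly_eq_linear_mult by blast
      have R1nz: "R1 \<noteq> 0" using Rnz R1 by auto
      have dR: "degree R = Suc (degree R1)" unfolding R1 degree_linear_mult[OF R1nz] by simp
      have "ae_T (\<lambda>z. norm (poly A1 z) = norm (poly R1 z))"
      proof (rule ae_T_mp[OF less.prems(3) ae_T_I], rule impI)
        fix z assume z: "norm z = 1" and e: "norm (poly A z) = norm (poly R z)"
        have "z \<noteq> b" using z nb by auto
        moreover have "norm ((z - b) * poly A1 z) = norm ((z - b) * poly R1 z)"
          using e by (simp add: A1 R1 algebra_simps)
        ultimately show "norm (poly A1 z) = norm (poly R1 z)" by (simp add: norm_mult)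
      qed
      then obtain c as where c: "norm c = 1" "\<forall>a\<in>set as. norm a < 1"
        "\<And>z. norm z = 1 \<Longrightarrow> poly R1 z = c * (\<Prod>a\<leftarrow>as. (z - a) / (1 - cnj a * z)) * poly A1 z"
        using less.hyps[of A1 R1] A1nz rA1 dA dR by auto
      show ?thesis
        by (intro exI[of _ c] exI[of _ as] conjI c allI impI) (simp add: A1 R1 c(3) algebra_simps)
    next
      define a where "a = 1 / cnj b"
      assume "poly R (1 / cnj b) = 0"
      then obtain R1 where R1: "R = [:-a, 1:] * R1" using poly_eq_linear_mult a_def by blast
      have na: "norm a < 1" using nb by (simp add: a_def norm_divide divide_less_eq)
      have R1nz: "R1 \<noteq> 0" using Rnz R1 by auto
      have dR: "degree R = Suc (degree R1)" unfolding R1 degree_linear_mult[OF R1nz] by simp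
      \<comment> \<open>z - b = - b (1 - cnj a z), so the scalar - b is absorbed in the remaining
        factor.\<close>
      define A2 where "A2 = smult (- b) A1"
      have A2: "poly A z = (1 - cnj a * z) * poly A2 z" for z
        using b0 by (simp add: A1 A2_def a_def field_simps)
      have A2nz: "A2 \<noteq> 0" and dA2: "degree A2 = degree A1" and rA2: "\<forall>a. poly A2 a = 0 \<longrightarrow> norm a > 1"
        using A1nz b0 rA1 by (auto simp: A2_def)
      have "ae_T (\<lambda>z. norm (poly A2 z) = norm (poly R1 z))"
      proof (rule ae_T_mp[OF less.prems(3) ae_T_I], rule impI)
        fix z assume z: "norm z = 1" and e: "norm (poly A z) = norm (poly R z)"
        have "poly R z = (z - a) * poly R1 z" by (simp add: R1 algebra_simps)
        then have "norm (z - a) * norm (poly A2 z) = norm (z - a) * norm (poly R1 z)"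
          using e blaschke_factor_circle(2)[OF z, of a] by (simp add: A2 norm_mult)
        then show "norm (poly A2 z) = norm (poly R1 z)" using circle_neq[OF z na] by simp
      qed
      then obtain c as where c: "norm c = 1" "\<forall>a\<in>set as. norm a < 1"
        "\<And>z. norm z = 1 \<Longrightarrow> poly R1 z = c * (\<Prod>a\<leftarrow>as. (z - a) / (1 - cnj a * z)) * poly A2 z"
        using less.hyps[of A2 R1] A2nz rA2 dA dR dA2 by auto
      show ?thesis
      proof (intro exI[of _ c] exI[of _ "a # as"] conjI c(1) allI impI)
        show "\<forall>a\<in>set (a # as). norm a < 1" using c na by simp
        fix z :: complex assume z: "norm z = 1"
        have "poly R z = (z - a) * poly R1 z" by (simp add: R1 algebra_simps)
        then show "poly R z = c * (\<Prod>a\<leftarrow>a # as. (z - a) / (1 - cnj a * z)) * poly A z"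
          using circle_neq[OF z na] by (simp add: A2 c(3)[OF z])
      qed
    qed
  next
    case False
    then have "degree A = 0"
      using fundamental_theorem_of_algebra constant_degree by blast
    then obtain \<alpha> where \<alpha>: "A = [:\<alpha>:]" by (rule degree_eq_zeroE)
    have \<alpha>0: "\<alpha> \<noteq> 0" using less.prems(1) \<alpha> by simp
    show ?thesis
    proof (cases "poly R 0 = 0")
      case True
      then obtain R1 where R1: "R = [:-0, 1:] * R1" using poly_eq_linear_mult by blast
      have R1nz: "R1 \<noteq> 0" using Rnz R1 by auto
      have dR: "degree R = Suc (degree R1)" unfolding R1 degree_linear_mult[OF R1nz] by simp
      have "ae_T (\<lambda>z. norm (poly A z) = norm (poly R1 z))"
        by (rule ae_T_mp[OF less.prems(3) ae_T_I]) (auto simp: R1 norm_mult)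
      then obtain c as where c: "norm c = 1" "\<forall>a\<in>set as. norm a < 1"
        "\<And>z. norm z = 1 \<Longrightarrow> poly R1 z = c * (\<Prod>a\<leftarrow>as. (z - a) / (1 - cnj a * z)) * poly A z"
        using less.hyps[of A R1] less.prems dR by auto
      show ?thesis
        by (intro exI[of _ c] exI[of _ "0 # as"] conjI allI impI) (use c in \<open>auto simp: R1\<close>)
    next
      case False
      have "degree R = 0"
      proof (rule ccontr)
        assume d: "degree R \<noteq> 0"
        \<comment> \<open>With A constant, one side of the reflection identity carries z^(degree R)
          and vanishes at 0. The reflected polynomial has nonzero value at 0, the conjugate of the
          leading coefficient of R.\<close>
        have "poly R 0 * poly (reflect_poly (map_poly cnj R)) 0 = 0"
          using arg_cong[OF poly_reflection_identity[OF less.prems(3)], of "\<lambda>p. poly p 0"] d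
          by (simp add: poly_monom \<alpha> zero_power)
        then show False using False Rnz by (simp add: map_poly_eq_0_iff)
      qed
      then obtain \<rho> where \<rho>: "R = [:\<rho>:]" by (rule degree_eq_zeroE)
      have "norm \<alpha> = norm \<rho>"
      proof (rule ccontr)
        assume "norm \<alpha> \<noteq> norm \<rho>"
        then show False using less.prems(3) ae_T_False by (simp add: \<alpha> \<rho>)
      qed
      then show ?thesis using \<alpha>0
        by (intro exI[of _ "\<rho> / \<alpha>"] exI[of _ "[]"]) (auto simp: \<alpha> \<rho> norm_divide)
    qed
  qed
qed

lemma rational_inner_finite_blaschke:
  assumes \<theta>: "inner_fn \<theta>" and "A \<noteq> 0" "ae_T (\<lambda>z. poly A z * \<theta> z = poly R z)"
  shows "\<exists>n. finite_blaschke n \<theta>"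
proof -
  have u: "ae_T (\<lambda>z. norm (\<theta> z) = 1)" and h: "H2 \<theta>" using \<theta> by (auto simp: inner_fn_def Hinf_H2)
  obtain A R where A: "A \<noteq> 0" "ae_T (\<lambda>z. poly A z * \<theta> z = poly R z)" "\<forall>a. poly A a = 0 \<longrightarrow> norm a > 1"
    using rational_inner_no_roots_in_disc[OF h u assms(2,3)] by blast
  have "ae_T (\<lambda>z. norm (poly A z) = norm (poly R z))"
    using A(2) u unfolding ae_T_circ by eventually_elim (metis mult.right_neutral norm_mult)
  then obtain c as where c: "norm c = 1" "\<forall>a\<in>set as. norm a < 1"
    "\<And>z. norm z = 1 \<Longrightarrow> poly R z = c * (\<Prod>a\<leftarrow>as. (z - a) / (1 - cnj a * z)) * poly A z"
    using unimodular_rational_blaschke[OF A(1,3)] by blast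
  have "ae_T (\<lambda>z. \<theta> z = c * (\<Prod>a\<leftarrow>as. (z - a) / (1 - cnj a * z)))"
  proof (rule ae_T_mp[OF A(2) ae_T_I], rule impI)
    fix z assume z: "norm z = 1" and e: "poly A z * \<theta> z = poly R z"
    have "poly A z \<noteq> 0" using A(3) z by auto
    then show "\<theta> z = c * (\<Prod>a\<leftarrow>as. (z - a) / (1 - cnj a * z))"
      using e c(3)[OF z] by (simp add: mult.commute)
  qed
  then show ?thesis unfolding finite_blaschke_def using c(1,2) by blast
qed

section \<open>Kernels of Toeplitz operators\<close>

lemma divide_unimodular: "norm w = 1 \<Longrightarrow> x / w = x * cnj w"
proof -
  assume w: "norm w = 1"
  then have "inverse w = cnj w" by (intro inverse_unique mult_cnj_circle)
  then show ?thesis by (simp add: divide_inverse)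
qed

text \<open>As |B| = 1, dividing by B is multiplying by \<open>cnj (B z)\<close>. Hence g gp q is
  the conjugate of \<open>cnj (gm z) * r z\<close>, an H^1 function with mean 0, so only negative
  frequencies survive.\<close>

lemma toeplitz_ker_member:
  assumes g: "Linf_T g" and gm: "H2 (\<lambda>z. cnj (gm z))" and gp: "H2 gp" "ae_T (\<lambda>z. gp z \<noteq> 0)"
    and B: "ae_T (\<lambda>z. norm (B z) = 1)" and geq: "ae_T (\<lambda>z. g z = gm z / B z / gp z)"
    and q: "Hinf q" and r: "Hinf r" "fourier_coeff r 0 = 0" "ae_T (\<lambda>z. B z * cnj (q z) = r z)"
  shows "(\<lambda>z. gp z * q z) \<in> toeplitz_ker g"
proof -
  have h: "H2 (\<lambda>z. gp z * q z)" using Hinf_mult_H2[OF q gp(1)] by (simp add: mult.commute)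
  have kr: "H1 (\<lambda>z. cnj (gm z) * r z)" "fourier_coeff (\<lambda>z. cnj (gm z) * r z) 0 = 0"
    using H2_mult[OF gm Hinf_H2[OF r(1)]] r(2) by auto
  have "fourier_coeff (\<lambda>z. g z * (gp z * q z)) n = 0" if "n \<ge> 0" for n
  proof -
    have "ae_T (\<lambda>z. g z * (gp z * q z) = cnj (cnj (gm z) * r z))"
      using gp(2) B geq r(3) unfolding ae_T_circ
    proof eventually_elim
      case (elim t)
      have "g (cis t) * (gp (cis t) * q (cis t)) = gm (cis t) / B (cis t) * q (cis t)"
        using elim(1,3) by simp
      also have "\<dots> = gm (cis t) * (cnj (B (cis t)) * q (cis t))"
        using divide_unimodular[OF elim(2)] by simp
      also have "\<dots> = cnj (cnj (gm (cis t)) * r (cis t))"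
        by (simp flip: elim(4))
      finally show ?case .
    qed
    then have "fourier_coeff (\<lambda>z. g z * (gp z * q z)) n = fourier_coeff (\<lambda>z. cnj (cnj (gm z) * r z)) n"
      using g h kr by (intro fourier_coeff_cong meas_T_cnj[OF meas_T_L1] meas_T_mult meas_T_L2[OF H2_L2[OF h]])
        (auto simp: Linf_T_def H1_def)
    also have "\<dots> = cnj (fourier_coeff (\<lambda>z. cnj (gm z) * r z) (- n))" by (rule fourier_coeff_cnj)
    also have "\<dots> = 0" using kr that by (cases "n = 0") (auto simp: H1_def)
    finally show ?thesis .
  qed
  then show ?thesis using h by (simp add: toeplitz_ker_def)
qed

lemma toeplitz_ker_sum:
  assumes g: "Linf_T g" and f: "\<And>i. i \<in> I \<Longrightarrow> f i \<in> toeplitz_ker g"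
  shows "(\<lambda>z. \<Sum>i\<in>I. c i * f i z) \<in> toeplitz_ker g"
proof -
  have H: "H2 (f i)" "\<And>n. n \<ge> 0 \<Longrightarrow> fourier_coeff (\<lambda>z. g z * f i z) n = 0" if "i \<in> I" for i
    using f[OF that] by (auto simp: toeplitz_ker_def)
  have "fourier_coeff (\<lambda>z. g z * (\<Sum>i\<in>I. c i * f i z)) n = 0" if "n \<ge> 0" for n
  proof -
    have "(\<lambda>z. g z * (\<Sum>i\<in>I. c i * f i z)) = (\<lambda>z. \<Sum>i\<in>I. c i * (g z * f i z))"
      by (simp add: sum_distrib_left mult_ac)
    moreover have "L1_T (\<lambda>z. c i * (g z * f i z))" if "i \<in> I" for i
      by (rule L1_cmult[OF L2_L1[OF L2_Linf_mult[OF g H2_L2[OF H(1)[OF that]]]]])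
    ultimately have "fourier_coeff (\<lambda>z. g z * (\<Sum>i\<in>I. c i * f i z)) n
        = (\<Sum>i\<in>I. fourier_coeff (\<lambda>z. c i * (g z * f i z)) n)"
      by (simp only: fourier_coeff_sum)
    also have "\<dots> = 0" using H(2) that by (simp add: fourier_coeff_cmult)
    finally show ?thesis .
  qed
  moreover have "H2 (\<lambda>z. \<Sum>i\<in>I. c i * f i z)" by (intro H2_sum H2_cmult H)
  ultimately show ?thesis by (simp add: toeplitz_ker_def)
qed

text \<open>Transfers the case of exponent zero from F to h. It is applied with h = \<theta>^(-N) F
  for N \<le> 0, and with h the quotient of F by a Blaschke product for N > 0.\<close>

lemma toeplitz_ker_quotient_zero:
  assumes g: "Linf_T g"
    and gm: "H2 (\<lambda>z. cnj (gm z))" "outer_fn (\<lambda>z. cnj (gm z))"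
    and gp: "H2 gp" "outer_fn gp" "rigid (\<lambda>z. (gp z)\<^sup>2)"
    and F: "F \<in> toeplitz_ker g" and h: "H2 h"
    and eq: "ae_T (\<lambda>z. g z * F z = gm z * h z / gp z)"
  shows "ae_T (\<lambda>z. h z = 0)"
proof (rule toeplitz_kernel_trivial[OF gm gp h])
  have F2: "H2 F" and F0: "\<And>n. n \<ge> 0 \<Longrightarrow> fourier_coeff (\<lambda>z. g z * F z) n = 0"
    using F by (auto simp: toeplitz_ker_def)
  have L: "L2_T (\<lambda>z. g z * F z)" by (rule L2_Linf_mult[OF g H2_L2[OF F2]])
  have mg: "meas_T gm" using meas_T_cnj[OF meas_T_L2[OF H2_L2[OF gm(1)]]] by simp
  have m: "meas_T (\<lambda>z. gm z * h z / gp z)"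
    by (intro meas_T_divide meas_T_mult mg meas_T_L2[OF H2_L2] h gp)
  show "L2_T (\<lambda>z. gm z * h z / gp z)"
    by (rule L2_cong[OF L m]) (rule ae_T_mp[OF eq ae_T_I], simp)
  show "fourier_coeff (\<lambda>z. gm z * h z / gp z) n = 0" if "n \<ge> 0" for n
    using fourier_coeff_cong[OF meas_T_L2[OF L] m eq, of n] F0[OF that] by simp
qed

text \<open>The j-th iterate of the backward shift applied to \<theta>: drop the first j Taylor
  terms and divide by z^j. On the circle the division is harmless.\<close>

definition backward_shift :: "(complex \<Rightarrow> complex) \<Rightarrow> nat \<Rightarrow> complex \<Rightarrow> complex" where
  "backward_shift \<theta> j z = (\<theta> z - poly (\<Sum>i<j. monom (fourier_coeff \<theta> (int i)) i) z) / z ^ j"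

lemma Hinf_backward_shift:
  assumes "Hinf \<theta>"
  shows "Hinf (backward_shift \<theta> j)"
proof -
  define p where "p = (\<Sum>i<j. monom (fourier_coeff \<theta> (int i)) i)"
  have d: "Hinf (\<lambda>z. \<theta> z - poly p z)" by (intro Hinf_diff assms Hinf_poly)
  then obtain C where C: "ae_T (\<lambda>z. norm (\<theta> z - poly p z) \<le> C)" and m: "meas_T (\<lambda>z. \<theta> z - poly p z)"
    by (auto simp: Hinf_def Linf_T_def)
  have s: "backward_shift \<theta> j = (\<lambda>z. (\<theta> z - poly p z) / poly (monom 1 j) z)"
    by (auto simp: backward_shift_def p_def poly_monom)
  have ms: "meas_T (backward_shift \<theta> j)" unfolding s by (intro meas_T_divide m meas_T_poly)
  have b: "ae_T (\<lambda>z. norm (backward_shift \<theta> j z) \<le> C)"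
    by (rule ae_T_mp[OF C ae_T_I]) (auto simp: s poly_monom norm_divide norm_power)
  show ?thesis
  proof (rule HinfI[OF ms b])
    fix n :: int assume n: "n < 0"
    have "fourier_coeff (backward_shift \<theta> j) n = fourier_coeff (\<lambda>z. z ^ j * backward_shift \<theta> j z) (n + int j)"
      by (simp add: fourier_coeff_power_mult)
    also have "\<dots> = fourier_coeff (\<lambda>z. \<theta> z - poly p z) (n + int j)"
    proof (intro fourier_coeff_cong m ae_T_I)
      show "meas_T (\<lambda>z. z ^ j * backward_shift \<theta> j z)"
        using meas_T_mult[OF meas_T_poly[of "monom 1 j"] ms] by (simp add: poly_monom)
      show "z ^ j * backward_shift \<theta> j z = \<theta> z - poly p z" if "norm z = 1" for z
        using that by (auto simp: backward_shift_def p_def)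
    qed
    also have "\<dots> = fourier_coeff \<theta> (n + int j) - fourier_coeff (poly p) (n + int j)"
      by (rule fourier_coeff_diff[OF H2_L1[OF Hinf_H2[OF assms]] L1_poly])
    also have "\<dots> = 0"
    proof (cases "n + int j < 0")
      case True
      then show ?thesis using assms by (simp add: fourier_coeff_poly Hinf_def)
    next
      case False
      \<comment> \<open>For negative n these are precisely the frequencies of the subtracted Taylor
        polynomial.\<close>
      then have "nat (n + int j) < j" "int (nat (n + int j)) = n + int j" using n by auto
      then show ?thesis using False
        by (simp add: fourier_coeff_poly p_def coeff_sum)
    qed
    finally show "fourier_coeff (backward_shift \<theta> j) n = 0" .
  qed
qed

text \<open>With p the Taylor polynomial dropped, |\<theta>| = 1 gives z^j (1 - \<theta> cnj p). As
  p has degree below j, \<open>z ^ j * cnj (poly p z)\<close> agrees on the circle with a polynomial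
  u vanishing at 0, so the result z^j - u \<theta> is analytic and vanishes at 0.\<close>

lemma mult_cnj_backward_shift:
  assumes \<theta>: "inner_fn \<theta>" and j: "j > 0"
  obtains r where "Hinf r" "fourier_coeff r 0 = 0" "ae_T (\<lambda>z. \<theta> z * cnj (backward_shift \<theta> j z) = r z)"
proof -
  define p where "p = (\<Sum>i<j. monom (fourier_coeff \<theta> (int i)) i)"
  define u where "u = (\<Sum>i<j. monom (cnj (fourier_coeff \<theta> (int i))) (j - i))"
  define r where "r = (\<lambda>z. poly (monom 1 j) z - poly u z * \<theta> z)"
  have H: "Hinf \<theta>" using \<theta> by (rule inner_fn_Hinf)
  have "Hinf r" unfolding r_def by (intro Hinf_diff Hinf_mult Hinf_poly H)
  moreover have "fourier_coeff r 0 = 0"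
  proof -
    have "poly u 0 = 0" by (auto simp: u_def poly_sum poly_monom zero_power intro!: sum.neutral)
    then have "fourier_coeff (\<lambda>z. poly u z * \<theta> z) 0 = 0"
      using H1_poly_mult(2)[OF H2_H1[OF Hinf_H2[OF H]], of u] by simp
    then show ?thesis
      unfolding r_def fourier_coeff_diff[OF L1_poly L1_poly_mult[OF H2_L1[OF Hinf_H2[OF H]]]]
      using j by (simp add: fourier_coeff_poly)
  qed
  moreover have "ae_T (\<lambda>z. \<theta> z * cnj (backward_shift \<theta> j z) = r z)"
  proof (rule ae_T_mp[OF _ ae_T_I])
    show "ae_T (\<lambda>z. norm (\<theta> z) = 1)" using \<theta> by (simp add: inner_fn_def)
    fix z :: complex assume z: "norm z = 1"
    have zi: "z ^ i * cnj z ^ i = 1" for i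
      using mult_cnj_circle[OF z] by (simp flip: power_mult_distrib)
    have "z ^ j * cnj (poly p z) = (\<Sum>i<j. cnj (fourier_coeff \<theta> (int i)) * (z ^ j * cnj z ^ i))"
      by (simp add: p_def poly_sum poly_monom sum_distrib_left mult_ac)
    also have "\<dots> = poly u z"
      unfolding u_def poly_sum
    proof (intro sum.cong refl)
      fix i assume "i \<in> {..<j}"
      then have "z ^ j = z ^ (j - i) * z ^ i" by (simp flip: power_add)
      then have "z ^ j * cnj z ^ i = z ^ (j - i)" using zi[of i] by (simp add: mult.assoc)
      then show "cnj (fourier_coeff \<theta> (int i)) * (z ^ j * cnj z ^ i)
          = poly (monom (cnj (fourier_coeff \<theta> (int i))) (j - i)) z" by (simp add: poly_monom)
    qed
    finally have pu: "z ^ j * cnj (poly p z) = poly u z" .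
    show "norm (\<theta> z) = 1 \<longrightarrow> \<theta> z * cnj (backward_shift \<theta> j z) = r z"
    proof
      assume t: "norm (\<theta> z) = 1"
      have "cnj (backward_shift \<theta> j z) = cnj (\<theta> z - poly p z) * z ^ j"
        using z divide_unimodular[of "z ^ j" "\<theta> z - poly p z"]
        by (simp add: backward_shift_def p_def norm_power)
      then have "\<theta> z * cnj (backward_shift \<theta> j z) = \<theta> z * (cnj (\<theta> z - poly p z) * z ^ j)"
        by (simp only:)
      also have "\<dots> = z ^ j * (\<theta> z * cnj (\<theta> z)) - \<theta> z * (z ^ j * cnj (poly p z))"
        by (simp add: algebra_simps)
      finally have "\<theta> z * cnj (backward_shift \<theta> j z) = \<dots>" .
      then show "\<theta> z * cnj (backward_shift \<theta> j z) = r z"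
        unfolding pu mult_cnj_circle[OF t] by (simp add: r_def poly_monom mult.commute)
    qed
  qed
  ultimately show ?thesis using that by blast
qed

lemma mult_backward_shift_in_toeplitz_ker:
  assumes g: "Linf_T g" and gm: "H2 (\<lambda>z. cnj (gm z))" and gp: "H2 gp" "ae_T (\<lambda>z. gp z \<noteq> 0)"
    and \<theta>: "inner_fn \<theta>" and geq: "ae_T (\<lambda>z. g z = gm z / \<theta> z ^ Suc m / gp z)" and j: "j > 0"
  shows "(\<lambda>z. gp z * backward_shift \<theta> j z) \<in> toeplitz_ker g"
proof (rule mult_cnj_backward_shift[OF \<theta> j])
  fix r assume r: "Hinf r" "fourier_coeff r 0 = 0" "ae_T (\<lambda>z. \<theta> z * cnj (backward_shift \<theta> j z) = r z)"
  have u: "ae_T (\<lambda>z. norm (\<theta> z) = 1)" using \<theta> by (simp add: inner_fn_def)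
  have H: "Hinf (\<lambda>z. \<theta> z ^ m)" by (intro Hinf_power inner_fn_Hinf \<theta>)
  show ?thesis
  proof (rule toeplitz_ker_member[OF g gm gp _ geq Hinf_backward_shift[OF inner_fn_Hinf[OF \<theta>]]])
    show "ae_T (\<lambda>z. norm (\<theta> z ^ Suc m) = 1)"
      by (rule ae_T_mp[OF u ae_T_I]) (simp add: norm_power norm_mult)
    show "Hinf (\<lambda>z. \<theta> z ^ m * r z)" by (intro Hinf_mult H r)
    show "fourier_coeff (\<lambda>z. \<theta> z ^ m * r z) 0 = 0"
      using H2_mult(2)[OF Hinf_H2[OF H] Hinf_H2[OF r(1)]] r(2) by simp
    show "ae_T (\<lambda>z. \<theta> z ^ Suc m * cnj (backward_shift \<theta> j z) = \<theta> z ^ m * r z)"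
      by (rule ae_T_mp[OF r(3) ae_T_I]) (auto simp: mult_ac)
  qed
qed

text \<open>Multiplying a relation by z^d clears all denominators and leaves a polynomial multiple
  of \<theta> equal to a polynomial.\<close>

lemma backward_shift_dependent_rational:
  assumes dep: "ae_T (\<lambda>z. (\<Sum>i<d. c i * backward_shift \<theta> (Suc i) z) = 0)" and i: "i0 < d" "c i0 \<noteq> 0"
  obtains A R where "A \<noteq> 0" "ae_T (\<lambda>z. poly A z * \<theta> z = poly R z)"
proof -
  define p where "p = (\<lambda>j. \<Sum>i<j. monom (fourier_coeff \<theta> (int i)) i)"
  define A where "A = (\<Sum>i<d. monom (c i) (d - Suc i))"
  define R where "R = (\<Sum>i<d. monom (c i) (d - Suc i) * p (Suc i))"
  \<comment> \<open>The exponents d - Suc i are distinct for i < d, so no cancellation occurs and A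
    is nonzero.\<close>
  have "coeff A (d - Suc i0) = (\<Sum>i<d. if i = i0 then c i else 0)"
    unfolding A_def coeff_sum using i by (intro sum.cong) auto
  then have "A \<noteq> 0" using i by (auto simp: sum.delta)
  moreover have "ae_T (\<lambda>z. poly A z * \<theta> z = poly R z)"
  proof (rule ae_T_mp[OF dep ae_T_I], rule impI)
    fix z :: complex assume z: "norm z = 1" and e: "(\<Sum>i<d. c i * backward_shift \<theta> (Suc i) z) = 0"
    have z0: "z \<noteq> 0" using z by auto
    have "poly A z * \<theta> z - poly R z = (\<Sum>i<d. c i * z ^ (d - Suc i) * (\<theta> z - poly (p (Suc i)) z))"
      by (simp add: A_def R_def poly_sum poly_monom sum_distrib_right right_diff_distrib sum_subtractf)
    also have "\<dots> = (\<Sum>i<d. z ^ d * (c i * backward_shift \<theta> (Suc i) z))"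
    proof (intro sum.cong refl)
      fix i assume "i \<in> {..<d}"
      then have "z ^ d = z ^ (d - Suc i) * z ^ Suc i" by (simp only: lessThan_iff flip: power_add) simp
      then show "c i * z ^ (d - Suc i) * (\<theta> z - poly (p (Suc i)) z) = z ^ d * (c i * backward_shift \<theta> (Suc i) z)"
        using z0 by (simp add: backward_shift_def p_def)
    qed
    also have "\<dots> = 0" using e by (simp flip: sum_distrib_left)
    finally show "poly A z * \<theta> z = poly R z" by simp
  qed
  ultimately show ?thesis using that by blast
qed

lemma Hinf_cauchy_kernel_prod:
  "\<forall>a\<in>set as. norm a < 1 \<Longrightarrow> Hinf (\<lambda>z. \<Prod>a\<leftarrow>as. 1 / (1 - cnj a * z))"
proof (induction as)
  case Nil
  then show ?case by (simp add: Hinf_const)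
next
  case (Cons a as)
  then have "Hinf (\<lambda>z. 1 / (1 - cnj a * z) * (\<Prod>a\<leftarrow>as. 1 / (1 - cnj a * z)))"
    by (intro Hinf_mult Hinf_cauchy_kernel) auto
  then show ?case by simp
qed

lemma cauchy_kernel_prod_nonzero:
  "\<forall>a\<in>set as. norm a < 1 \<Longrightarrow> norm z = 1 \<Longrightarrow> (\<Prod>a\<leftarrow>as. 1 / (1 - cnj a * z)) \<noteq> 0"
  using circle_neq by (induction as) auto

text \<open>Factor by factor: on the circle z cnj (1 - cnj a z) = z - a, so each numerator divided
  by the conjugated denominator is z.\<close>

lemma blaschke_mult_cnj_kernel:
  assumes "\<forall>a\<in>set as. norm a < 1" and z: "norm z = 1"
  shows "(\<Prod>a\<leftarrow>as. (z - a) / (1 - cnj a * z)) * cnj (\<Prod>a\<leftarrow>as. 1 / (1 - cnj a * z))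
    = z ^ length as * (\<Prod>a\<leftarrow>as. 1 / (1 - cnj a * z))"
  using assms(1)
proof (induction as)
  case (Cons a as)
  have "cnj z * (z - a) = cnj (1 - cnj a * z)"
    by (simp add: blaschke_factor_circle(1)[OF z])
  then have "z * cnj (1 - cnj a * z) = z - a"
    using mult_cnj_circle[OF z] by (metis mult.assoc mult_1)
  moreover have "cnj (1 - cnj a * z) \<noteq> 0"
    using circle_neq[OF z, of a] Cons.prems by (metis complex_cnj_zero_iff list.set_intros(1))
  ultimately have "(z - a) / cnj (1 - cnj a * z) = z" by (metis nonzero_mult_div_cancel_right)
  then have *: "(z - a) / (1 - cnj a * z) * cnj (1 / (1 - cnj a * z)) = z * (1 / (1 - cnj a * z))"
    by (metis complex_cnj_divide complex_cnj_one mult.right_neutral times_divide_eq_left times_divide_eq_right)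
  have "(\<Prod>a\<leftarrow>a # as. (z - a) / (1 - cnj a * z)) * cnj (\<Prod>a\<leftarrow>a # as. 1 / (1 - cnj a * z))
      = ((z - a) / (1 - cnj a * z) * cnj (1 / (1 - cnj a * z)))
        * ((\<Prod>a\<leftarrow>as. (z - a) / (1 - cnj a * z)) * cnj (\<Prod>a\<leftarrow>as. 1 / (1 - cnj a * z)))"
    by (simp only: list.map prod_list.Cons complex_cnj_mult mult_ac)
  also have "(\<Prod>a\<leftarrow>as. (z - a) / (1 - cnj a * z)) * cnj (\<Prod>a\<leftarrow>as. 1 / (1 - cnj a * z))
      = z ^ length as * (\<Prod>a\<leftarrow>as. 1 / (1 - cnj a * z))"
    using Cons by simp
  finally show ?case unfolding * by (simp only: list.map prod_list.Cons length_Cons power_Suc mult_ac)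
qed simp

text \<open>The upper bound for the dimension. With more functions than zeros, some nontrivial
  combination has zero remainder on division by the Blaschke product; its quotient satisfies the
  kernel condition of exponent zero and vanishes.\<close>

lemma toeplitz_ker_dependent:
  assumes g: "Linf_T g"
    and gm: "H2 (\<lambda>z. cnj (gm z))" "outer_fn (\<lambda>z. cnj (gm z))"
    and gp: "H2 gp" "outer_fn gp" "rigid (\<lambda>z. (gp z)\<^sup>2)"
    and c0: "norm c0 = 1" and as: "\<forall>a\<in>set as. norm a < 1"
    and geq: "ae_T (\<lambda>z. g z = gm z / (c0 * (\<Prod>a\<leftarrow>as. (z - a) / (1 - cnj a * z))) / gp z)"
    and fs: "set fs \<subseteq> toeplitz_ker g" "length as < length fs"
  shows "\<exists>c. (\<exists>i<length fs. c i \<noteq> 0) \<and> ae_T (\<lambda>z. (\<Sum>i<length fs. c i * (fs ! i) z) = 0)"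
proof -
  define b where "b = (\<lambda>z. \<Prod>a\<leftarrow>as. (z - a) / (1 - cnj a * z))"
  define e where "e = (\<lambda>j z. \<Prod>a\<leftarrow>take j as. (z - a) / (1 - cnj a * z))"
  have geq': "ae_T (\<lambda>z. g z = gm z / (c0 * b z) / gp z)" using geq by (simp add: b_def)
  have fK: "fs ! i \<in> toeplitz_ker g" if "i < length fs" for i using fs that nth_mem by blast
  \<comment> \<open>Remainder coefficients and quotient are packed as a pair so that one application
    of choice selects both.\<close>
  have "\<forall>i. \<exists>lh. i < length fs \<longrightarrow> H2 (snd lh) \<and> (\<forall>z. norm z = 1 \<longrightarrow>
      (fs ! i) z = (\<Sum>j<length as. fst lh j * e j z) + b z * snd lh z)"
  proof
    fix i
    show "\<exists>lh. i < length fs \<longrightarrow> H2 (snd lh) \<and> (\<forall>z. norm z = 1 \<longrightarrow>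
      (fs ! i) z = (\<Sum>j<length as. fst lh j * e j z) + b z * snd lh z)"
    proof (cases "i < length fs")
      case True
      then have "H2 (fs ! i)" using fK by (simp add: toeplitz_ker_def)
      from H2_divide_blaschke[OF this as] obtain l h where "H2 h"
        "\<forall>z. norm z = 1 \<longrightarrow> (fs ! i) z = (\<Sum>j<length as. l j * e j z) + b z * h z"
        unfolding b_def e_def by blast
      then show ?thesis by (intro exI[of _ "(l, h)"]) simp
    qed simp
  qed
  from choice[OF this] obtain lh where lh0: "\<forall>i<length fs. H2 (snd (lh i)) \<and> (\<forall>z. norm z = 1 \<longrightarrow>
      (fs ! i) z = (\<Sum>j<length as. fst (lh i) j * e j z) + b z * snd (lh i) z)"
    by blast
  define l where "l = (\<lambda>i. fst (lh i))"
  define h where "h = (\<lambda>i. snd (lh i))"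
  have lh: "\<And>i. i < length fs \<Longrightarrow> H2 (h i)"
    "\<And>i z. i < length fs \<Longrightarrow> norm z = 1 \<Longrightarrow> (fs ! i) z = (\<Sum>j<length as. l i j * e j z) + b z * h i z"
    using lh0 by (simp_all add: l_def h_def)
  obtain c where c: "\<exists>i\<in>{..<length fs}. c i \<noteq> 0" "\<And>j. j < length as \<Longrightarrow> (\<Sum>i<length fs. c i * l i j) = 0"
    using homogeneous_system_nontrivial_solution[of "{..<length fs}" "length as" l] fs(2)
    unfolding card_lessThan by blast
  define F where "F = (\<lambda>z. \<Sum>i<length fs. c i * (fs ! i) z)"
  define h' where "h' = (\<lambda>z. 1 / c0 * (\<Sum>i<length fs. c i * h i z))"
  have F: "F \<in> toeplitz_ker g" unfolding F_def by (rule toeplitz_ker_sum[OF g]) (use fK in auto)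
  have h': "H2 h'" unfolding h'_def by (intro H2_cmult H2_sum) (use lh in auto)
  have c00: "c0 \<noteq> 0" using c0 by auto
  have Fh: "F z = c0 * b z * h' z" if z: "norm z = 1" for z
  proof -
    have "F z = (\<Sum>i<length fs. c i * (\<Sum>j<length as. l i j * e j z)) + (\<Sum>i<length fs. c i * (b z * h i z))"
    proof -
      have "F z = (\<Sum>i<length fs. c i * ((\<Sum>j<length as. l i j * e j z) + b z * h i z))"
        unfolding F_def by (intro sum.cong refl) (simp only: lh(2)[OF _ z] lessThan_iff)
      then show ?thesis by (simp only: distrib_left sum.distrib)
    qed
    also have "(\<Sum>i<length fs. c i * (\<Sum>j<length as. l i j * e j z))
        = (\<Sum>j<length as. (\<Sum>i<length fs. c i * l i j) * e j z)"
      by (simp only: sum_distrib_left sum_distrib_right mult.assoc) (rule sum.swap)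
    also have "\<dots> = 0" using c(2) by simp
    also have "(\<Sum>i<length fs. c i * (b z * h i z)) = c0 * b z * h' z"
    proof -
      have "(\<Sum>i<length fs. c i * (b z * h i z)) = b z * (\<Sum>i<length fs. c i * h i z)"
        by (simp only: sum_distrib_left mult.left_commute)
      then show ?thesis using c00 by (simp add: h'_def)
    qed
    finally show ?thesis by simp
  qed
  have "ae_T (\<lambda>z. h' z = 0)"
  proof (rule toeplitz_ker_quotient_zero[OF g gm gp F h'])
    show "ae_T (\<lambda>z. g z * F z = gm z * h' z / gp z)"
    proof (rule ae_T_mp[OF geq' ae_T_I], rule impI)
      fix z assume z: "norm z = 1" and ge: "g z = gm z / (c0 * b z) / gp z"
      have "b z \<noteq> 0" using as circle_neq[OF z] by (auto simp: b_def prod_list_zero_iff)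
      then show "g z * F z = gm z * h' z / gp z"
        unfolding ge Fh[OF z] using c00 by simp
    qed
  qed
  then have "ae_T (\<lambda>z. F z = 0)" by (rule ae_T_mp[OF _ ae_T_I]) (simp add: Fh)
  then show ?thesis using c(1) unfolding F_def by blast
qed

text \<open>Spanning follows from dependence of \<open>fs @ [f]\<close>: independence of fs forces a
  nonzero coefficient at f, and one solves for f.\<close>

lemma dim_T_eqI:
  assumes fs: "length fs = d" "set fs \<subseteq> K" "lin_indep_T fs"
    and dep: "\<And>hs. set hs \<subseteq> K \<Longrightarrow> length hs = Suc d \<Longrightarrow>
      \<exists>c. (\<exists>i<length hs. c i \<noteq> 0) \<and> ae_T (\<lambda>z. (\<Sum>i<length hs. c i * (hs ! i) z) = 0)"
  shows "dim_T_eq K d"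
  unfolding dim_T_eq_def
proof (intro exI[of _ fs] conjI fs ballI)
  fix f assume f: "f \<in> K"
  obtain c where c: "\<exists>i<Suc d. c i \<noteq> 0" "ae_T (\<lambda>z. (\<Sum>i<Suc d. c i * ((fs @ [f]) ! i) z) = 0)"
  proof -
    have S: "set (fs @ [f]) \<subseteq> K" "length (fs @ [f]) = Suc d" using f fs by auto
    show ?thesis using dep[OF S] that unfolding S(2) by blast
  qed
  have s: "(\<Sum>i<Suc d. c i * ((fs @ [f]) ! i) z) = (\<Sum>i<d. c i * (fs ! i) z) + c d * f z" for z
    using fs(1) by (simp add: nth_append)
  have "c d \<noteq> 0"
  proof
    assume cd: "c d = 0"
    then have "ae_T (\<lambda>z. (\<Sum>i<length fs. c i * (fs ! i) z) = 0)" using c(2) fs(1) unfolding s by simp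
    then have "\<forall>i<d. c i = 0" using fs(1,3) unfolding lin_indep_T_def by blast
    then show False using c(1) cd less_Suc_eq by blast
  qed
  then have "ae_T (\<lambda>z. f z = (\<Sum>i<d. (- c i / c d) * (fs ! i) z))"
  proof -
    have "f z = (\<Sum>i<d. (- c i / c d) * (fs ! i) z)" if "(\<Sum>i<d. c i * (fs ! i) z) + c d * f z = 0" for z
    proof -
      have "(\<Sum>i<d. (- c i / c d) * (fs ! i) z) = - (\<Sum>i<d. c i * (fs ! i) z) / c d"
        unfolding sum_negf[symmetric] sum_divide_distrib by (intro sum.cong) auto
      also have "- (\<Sum>i<d. c i * (fs ! i) z) = c d * f z"
        using that by (simp add: add_eq_0_iff)
      also have "c d * f z / c d = f z" using \<open>c d \<noteq> 0\<close> by simp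
      finally show ?thesis by simp
    qed
    then show ?thesis by (intro ae_T_mp[OF c(2)[unfolded s] ae_T_I] impI)
  qed
  then show "\<exists>c. ae_T (\<lambda>z. f z = (\<Sum>i<d. c i * (fs ! i) z))"
    by (rule exI[of "\<lambda>c. ae_T (\<lambda>z. f z = (\<Sum>i<d. c i * (fs ! i) z))"])
qed

lemma toeplitz_ker_dim_blaschke:
  assumes g: "Linf_T g"
    and gm: "H2 (\<lambda>z. cnj (gm z))" "outer_fn (\<lambda>z. cnj (gm z))"
    and gp: "H2 gp" "outer_fn gp" "rigid (\<lambda>z. (gp z)\<^sup>2)"
    and c0: "norm c0 = 1" and as: "\<forall>a\<in>set as. norm a < 1"
    and geq: "ae_T (\<lambda>z. g z = gm z / (c0 * (\<Prod>a\<leftarrow>as. (z - a) / (1 - cnj a * z))) / gp z)"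
  shows "dim_T_eq (toeplitz_ker g) (length as)"
proof -
  define d where "d = length as"
  define D where "D = (\<lambda>z. \<Prod>a\<leftarrow>as. 1 / (1 - cnj a * z))"
  define B where "B = (\<lambda>z. c0 * (\<Prod>a\<leftarrow>as. (z - a) / (1 - cnj a * z)))"
  \<comment> \<open>B cnj (q j) is c0 z^(d - j) D on the circle: analytic, and zero at the origin
    exactly because j < d.\<close>
  define q where "q = (\<lambda>j z. poly (monom 1 j) z * D z)"
  define fs where "fs = map (\<lambda>j z. gp z * q j z) [0..<d]"
  have nz: "ae_T (\<lambda>z. gp z \<noteq> 0)" using outer_fn_nonzero_ae gp by blast
  have D: "Hinf D" unfolding D_def by (rule Hinf_cauchy_kernel_prod[OF as])
  have q: "Hinf (q j)" for j unfolding q_def by (intro Hinf_mult Hinf_poly D)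
  have Bu: "norm (B z) = 1" if z: "norm z = 1" for z
  proof -
    have "norm (\<Prod>a\<leftarrow>as. (z - a) / (1 - cnj a * z)) = 1"
      using as by (induction as) (use circle_neq[OF z] blaschke_factor_circle(2)[OF z] in \<open>auto simp: norm_mult norm_divide\<close>)
    then show ?thesis using c0 by (simp add: B_def norm_mult)
  qed
  have mem: "(\<lambda>z. gp z * q j z) \<in> toeplitz_ker g" if j: "j < d" for j
  proof (rule toeplitz_ker_member[OF g gm(1) gp(1) nz _ _ q])
    show "ae_T (\<lambda>z. norm (B z) = 1)" by (intro ae_T_I Bu)
    show "ae_T (\<lambda>z. g z = gm z / B z / gp z)" using geq by (simp add: B_def)
    show "Hinf (\<lambda>z. poly (monom c0 (d - j)) z * D z)" by (intro Hinf_mult Hinf_poly D)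
    show "fourier_coeff (\<lambda>z. poly (monom c0 (d - j)) z * D z) 0 = 0"
      using H1_poly_mult(2)[OF H2_H1[OF Hinf_H2[OF D]], of "monom c0 (d - j)"] j by (simp add: poly_monom)
    show "ae_T (\<lambda>z. B z * cnj (q j z) = poly (monom c0 (d - j)) z * D z)"
    proof (rule ae_T_I)
      fix z :: complex assume z: "norm z = 1"
      have "z ^ d = z ^ (d - j) * z ^ j" using j by (simp flip: power_add)
      moreover have "z ^ j * cnj z ^ j = 1" using mult_cnj_circle[OF z] by (simp flip: power_mult_distrib)
      ultimately have zd: "cnj z ^ j * z ^ d = z ^ (d - j)" by (simp add: mult_ac)
      have "B z * cnj (q j z) = c0 * cnj z ^ j * ((\<Prod>a\<leftarrow>as. (z - a) / (1 - cnj a * z)) * cnj (D z))"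
        by (simp add: B_def q_def poly_monom mult_ac)
      also have "\<dots> = c0 * (cnj z ^ j * z ^ d) * D z"
        unfolding D_def blaschke_mult_cnj_kernel[OF as z] d_def by (simp add: mult_ac)
      finally show "B z * cnj (q j z) = poly (monom c0 (d - j)) z * D z"
        unfolding zd by (simp add: poly_monom)
    qed
  qed
  have "lin_indep_T fs"
    unfolding lin_indep_T_def
  proof (rule allI, rule impI)
    fix c assume e: "ae_T (\<lambda>z. (\<Sum>i<length fs. c i * (fs ! i) z) = 0)"
    define p where "p = (\<Sum>i<d. monom (c i) i)"
    have "(\<Sum>i<length fs. c i * (fs ! i) z) = gp z * D z * poly p z" for z
      by (simp add: fs_def q_def p_def poly_sum poly_monom sum_distrib_left mult_ac)
    then have "ae_T (\<lambda>z. gp z * D z * poly p z = 0)" using e by simp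
    then have "ae_T (\<lambda>z. gp z \<noteq> 0 \<longrightarrow> poly p z = 0)"
      by (rule ae_T_mp[OF _ ae_T_I]) (use cauchy_kernel_prod_nonzero[OF as] in \<open>auto simp: D_def\<close>)
    then have "ae_T (\<lambda>z. poly p z = 0)" by (rule ae_T_mp[OF nz])
    then have p0: "p = 0" by (rule poly_eq_0_if_ae)
    have "c i = 0" if "i < d" for i
    proof -
      have "coeff p i = c i" using that by (simp add: p_def coeff_sum)
      then show ?thesis using p0 by simp
    qed
    then show "\<forall>i<length fs. c i = 0" by (simp add: fs_def)
  qed
  moreover have "length fs = d" "set fs \<subseteq> toeplitz_ker g" using mem by (auto simp: fs_def)
  ultimately have "dim_T_eq (toeplitz_ker g) d"
    by (intro dim_T_eqI[of fs] toeplitz_ker_dependent[OF g gm gp c0 as geq]) (simp_all add: d_def)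
  then show ?thesis by (simp add: d_def)
qed

lemma prod_list_concat_replicate:
  "(\<Prod>a\<leftarrow>concat (replicate m as). f a) = (\<Prod>a\<leftarrow>as. f a :: complex) ^ m"
  by (induction m) auto

theorem theorem2:
  fixes g gm gp \<theta> :: "complex \<Rightarrow> complex" and N :: int
  assumes "Linf_T g"
    and "H2 (\<lambda>z. cnj (gm z))" and "outer_fn (\<lambda>z. cnj (gm z))"
    and "H2 gp" and "outer_fn gp"
    and "rigid (\<lambda>z. (gp z)\<^sup>2)"
    and "inner_fn \<theta>" and "\<not> (\<exists>c. ae_T (\<lambda>z. \<theta> z = c))"
    and "ae_T (\<lambda>z. g z = gm z * (\<theta> z) powi (- N) / gp z)"
  shows "((\<exists>f\<in>toeplitz_ker g. \<not> ae_T (\<lambda>z. f z = 0)) \<longleftrightarrow> N > 0)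
    \<and> (\<forall>n. N > 0 \<and> finite_blaschke n \<theta> \<longrightarrow> dim_T_eq (toeplitz_ker g) (n * nat N))
    \<and> (N > 0 \<and> \<not> (\<exists>n. finite_blaschke n \<theta>) \<longrightarrow> dim_T_infinite (toeplitz_ker g))"
proof -
  note g = assms(1) and gm = assms(2,3) and gp = assms(4,5,6) and \<theta> = assms(7)
  have nz: "ae_T (\<lambda>z. gp z \<noteq> 0)" using outer_fn_nonzero_ae gp by blast
  have u: "ae_T (\<lambda>z. norm (\<theta> z) = 1)" using \<theta> by (simp add: inner_fn_def)
  have geq: "ae_T (\<lambda>z. g z = gm z / \<theta> z ^ nat N / gp z)" if "N > 0"
    using assms(9) that by (simp add: power_int_def divide_inverse power_inverse)
  have mem: "(\<lambda>z. gp z * backward_shift \<theta> j z) \<in> toeplitz_ker g" if "N > 0" "j > 0" for j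
    \<comment> \<open>As N > 0, \<open>nat N\<close> is the successor of \<open>nat N - 1\<close>;
      one factor \<theta> pairs with the backward shift, the others stay analytic.\<close>
    using mult_backward_shift_in_toeplitz_ker[OF g gm(1) gp(1) nz \<theta> _ that(2), of "nat N - 1"] geq that(1) by simp
  have pos: "\<exists>f\<in>toeplitz_ker g. \<not> ae_T (\<lambda>z. f z = 0)" if N: "N > 0"
  \<comment> \<open>The witness is gp (\<theta> - \<theta>(0)) / z, which vanishes a.e. only if
    \<theta> is constant.\<close>
  proof (intro bexI[OF _ mem[OF N, of 1]] notI)
    assume "ae_T (\<lambda>z. gp z * backward_shift \<theta> 1 z = 0)"
    then have "ae_T (\<lambda>z. \<theta> z = fourier_coeff \<theta> 0)"
      using nz unfolding ae_T_circ by eventually_elim (auto simp: backward_shift_def poly_monom)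
    then show False using assms(8) by blast
  qed simp
  have triv: "ae_T (\<lambda>z. f z = 0)" if N: "\<not> N > 0" and f: "f \<in> toeplitz_ker g" for f
  proof -
    define h where "h = (\<lambda>z. \<theta> z ^ nat (- N) * f z)"
    have "H2 h" unfolding h_def using f
      by (intro Hinf_mult_H2 Hinf_power inner_fn_Hinf \<theta>) (simp add: toeplitz_ker_def)
    moreover have "ae_T (\<lambda>z. g z * f z = gm z * h z / gp z)"
      by (rule ae_T_mp[OF assms(9) ae_T_I]) (use N in \<open>auto simp: h_def power_int_def\<close>)
    ultimately have "ae_T (\<lambda>z. h z = 0)"
      by (rule toeplitz_ker_quotient_zero[OF g gm gp f])
    then show ?thesis using u unfolding ae_T_circ by eventually_elim (auto simp: h_def)
  qed
  have fin: "dim_T_eq (toeplitz_ker g) (n * nat N)" if N: "N > 0" and b: "finite_blaschke n \<theta>" for n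
  proof -
    obtain c as where c: "norm c = 1" "length as = n" "\<forall>a\<in>set as. norm a < 1"
      "ae_T (\<lambda>z. \<theta> z = c * (\<Prod>a\<leftarrow>as. (z - a) / (1 - cnj a * z)))"
      using b unfolding finite_blaschke_def by blast
    \<comment> \<open>\<theta>^N is again a finite Blaschke product: every zero is repeated N times
      and the constant is c^N.\<close>
    let ?as = "concat (replicate (nat N) as)"
    have "ae_T (\<lambda>z. g z = gm z / (c ^ nat N * (\<Prod>a\<leftarrow>?as. (z - a) / (1 - cnj a * z))) / gp z)"
      unfolding prod_list_concat_replicate using c(4) geq[OF N] unfolding ae_T_circ
      by eventually_elim (simp add: power_mult_distrib)
    then have "dim_T_eq (toeplitz_ker g) (length ?as)"
      by (intro toeplitz_ker_dim_blaschke[OF g gm gp]) (use c in \<open>auto simp: norm_power\<close>)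
    then show ?thesis using c(2) by (simp add: length_concat sum_list_replicate mult.commute)
  qed
  have inf: "dim_T_infinite (toeplitz_ker g)" if N: "N > 0" and nb: "\<not> (\<exists>n. finite_blaschke n \<theta>)"
    unfolding dim_T_infinite_def
  proof
    fix d
    define fs where "fs = map (\<lambda>j z. gp z * backward_shift \<theta> (Suc j) z) [0..<d]"
    have "lin_indep_T fs"
      unfolding lin_indep_T_def
    proof (rule allI, rule impI, rule ccontr)
      fix c assume e: "ae_T (\<lambda>z. (\<Sum>i<length fs. c i * (fs ! i) z) = 0)"
        and "\<not> (\<forall>i<length fs. c i = 0)"
      then obtain i where i: "i < d" "c i \<noteq> 0" by (auto simp: fs_def)
      have eq: "(\<Sum>i<length fs. c i * (fs ! i) z) = gp z * (\<Sum>i<d. c i * backward_shift \<theta> (Suc i) z)" for z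
        by (simp add: fs_def sum_distrib_left mult_ac)
      have "ae_T (\<lambda>z. (\<Sum>i<d. c i * backward_shift \<theta> (Suc i) z) = 0)"
        using e nz unfolding eq ae_T_circ by eventually_elim auto
      then obtain A R where "A \<noteq> 0" "ae_T (\<lambda>z. poly A z * \<theta> z = poly R z)"
        using backward_shift_dependent_rational i by blast
      then show False using rational_inner_finite_blaschke[OF \<theta>] nb by blast
    qed
    then show "\<exists>fs. length fs = d \<and> set fs \<subseteq> toeplitz_ker g \<and> lin_indep_T fs"
      using mem[OF N] by (intro exI[of _ fs]) (auto simp: fs_def)
  qed
  show ?thesis using pos triv fin inf by blast
qed

end
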